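(* Let $\mathscr{C}$ be an $\mathbf{Ord}$-enriched category, $\mathcal{S}$ a class of subobjects, and $\mathcal{P}(\mathscr{C})$ the $\mathbf{Ord}$-enriched category of partial maps with the order $\le$. Let $(\mathcal{E},\mathcal{M})$ be an oplax weak factorisation system on $\mathscr{C}$ such that $\mathcal{E}$ is stable under pullbacks along morphisms in $\mathcal{S}$. Define classes of partial maps $\overline{\mathcal{E}}=\{f\mid\varphi_f\in\mathcal{E}\}$ and $\overline{\mathcal{M}}=\{f\mid\varphi_f\in\mathcal{M}\}$. Then $(\overline{\mathcal{E}},\overline{\mathcal{M}})$ is an oplax weak factorisation system on $\mathcal{P}(\mathscr{C})$.
   Context: An $\mathbf{Ord}$-enriched category is a category whose hom-sets are partially ordered with monotone composition. In an $\mathbf{Ord}$-enriched category: an oplax square $(u,v):f\to g$, for $f:A\to B$, $g:C\to D$, is a pair $u:A\to C$, $v:B\to D$ with $v\cdot f\le g\cdot u$. $f\perp_{\mathrm{oplax}}g$ means that for every oplax square $(u,v):f\to g$ there is $d:B\to C$ with $d\cdot f\le u$ and $v\le g\cdot d$. An oplax weak factorisation system is a pair $(\mathcal{L},\mathcal{R})$ of classes of morphisms with $\mathcal{R}=\{g\mid f\perp_{\mathrm{oplax}}g\ \forall f\in\mathcal{L}\}$, $\mathcal{L}=\{f\mid f\perp_{\mathrm{oplax}}g\ \forall g\in\mathcal{R}\}$, such that every morphism factors as $r\cdot l$ with $l\in\mathcal{L}$, $r\in\mathcal{R}$. Partial maps: the order of $\mathscr{C}$ is denoted $\sqsubseteq$.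 $\mathcal{S}$ is a class of monomorphisms of $\mathscr{C}$ closed under composition, stable under pullback and containing all sections (split monomorphisms); $\mathscr{C}$ has pullbacks along morphisms in $\mathcal{S}$; every $s\in\mathcal{S}$ is full, i.e. $s\cdot a\sqsubseteq s\cdot b$ implies $a\sqsubseteq b$. $\mathcal{P}(\mathscr{C})$ has the objects of $\mathscr{C}$; a morphism (partial map) $f:A\to B$ is a span $(\sigma_f,\varphi_f)$ with $\sigma_f:D_f\rightarrowtail A$ in $\mathcal{S}$ and $\varphi_f:D_f\to B$ in $\mathscr{C}$ (spans being identified up to isomorphism). The composite $g\cdot f$ has $D_{g\cdot f}$ the pullback of $\sigma_g$ along $\varphi_f$, $\sigma_{g\cdot f}=\sigma_f\cdot\varphi_f^*(\sigma_g)$, $\varphi_{g\cdot f}=\varphi_g\cdot\sigma_g^*(\varphi_f)$. The order is: $f\le g$ iff there is $s:D_f\rightarrowtail D_g$ in $\mathcal{S}$ with $\sigma_f=\sigma_g\cdot s$ and $\varphi_f\sqsubseteq\varphi_g\cdot s$. It is assumed that with this order $\mathcal{P}(\mathscr{C})$ is $\mathbf{Ord}$-enriched (composition is monotone). *)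

theory Defs
  imports Main
begin

section \<open>Ord-enriched categories\<close>

record ('o, 'a) ord_cat =
  Obj :: "'o set"
  Arr :: "'a set"
  Dom :: "'a \<Rightarrow> 'o"
  Cod :: "'a \<Rightarrow> 'o"
  Id :: "'o \<Rightarrow> 'a"
  Comp :: "'a \<Rightarrow> 'a \<Rightarrow> 'a"  (infixr \<open>\<cdot>\<index>\<close> 70)
  Le :: "'a \<Rightarrow> 'a \<Rightarrow> bool"  (infix \<open>\<sqsubseteq>\<index>\<close> 50)

definition hom :: "('o, 'a, 'm) ord_cat_scheme \<Rightarrow> 'o \<Rightarrow> 'o \<Rightarrow> 'a set" where
  "hom C A B = {f \<in> Arr C. Dom C f = A \<and> Cod C f = B}"

text \<open>Composites \<open>g \<cdot> f\<close> are only meaningful when \<open>Cod f = Dom g\<close>, and \<open>f \<sqsubseteq> g\<close> only for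
  parallel \<open>f\<close> and \<open>g\<close>; other values are unspecified.\<close>

locale category =
  fixes C (structure)
  assumes Dom_in_Obj: "f \<in> Arr C \<Longrightarrow> Dom C f \<in> Obj C"
    and Cod_in_Obj: "f \<in> Arr C \<Longrightarrow> Cod C f \<in> Obj C"
    and Id_in_hom: "A \<in> Obj C \<Longrightarrow> Id C A \<in> hom C A A"
    and Comp_in_hom: "\<lbrakk>f \<in> hom C A B; g \<in> hom C B D\<rbrakk> \<Longrightarrow> g \<cdot> f \<in> hom C A D"
    and Comp_Id: "f \<in> hom C A B \<Longrightarrow> f \<cdot> Id C A = f"
    and Id_Comp: "f \<in> hom C A B \<Longrightarrow> Id C B \<cdot> f = f"
    and Comp_assoc: "\<lbrakk>f \<in> hom C A B; g \<in> hom C B D; h \<in> hom C D E\<rbrakk>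
      \<Longrightarrow> h \<cdot> (g \<cdot> f) = (h \<cdot> g) \<cdot> f"

definition monotone_comp :: "('o, 'a, 'm) ord_cat_scheme \<Rightarrow> bool" where
  "monotone_comp C \<longleftrightarrow>
    (\<forall>A B D. \<forall>f \<in> hom C A B. \<forall>f' \<in> hom C A B. \<forall>g \<in> hom C B D. \<forall>g' \<in> hom C B D.
      f \<sqsubseteq>\<^bsub>C\<^esub> f' \<longrightarrow> g \<sqsubseteq>\<^bsub>C\<^esub> g' \<longrightarrow> g \<cdot>\<^bsub>C\<^esub> f \<sqsubseteq>\<^bsub>C\<^esub> g' \<cdot>\<^bsub>C\<^esub> f')"

locale ord_category = category +
  assumes Le_refl: "f \<in> hom C A B \<Longrightarrow> f \<sqsubseteq> f"
    and Le_trans: "\<lbrakk>f \<in> hom C A B; g \<in> hom C A B; h \<in> hom C A B; f \<sqsubseteq> g; g \<sqsubseteq> h\<rbrakk> \<Longrightarrow> f \<sqsubseteq> h"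
    and Le_antisym: "\<lbrakk>f \<in> hom C A B; g \<in> hom C A B; f \<sqsubseteq> g; g \<sqsubseteq> f\<rbrakk> \<Longrightarrow> f = g"
    and Comp_mono: "monotone_comp C"

definition is_mono :: "('o, 'a, 'm) ord_cat_scheme \<Rightarrow> 'a \<Rightarrow> bool" where
  "is_mono C s \<longleftrightarrow> s \<in> Arr C \<and>
    (\<forall>X. \<forall>a \<in> hom C X (Dom C s). \<forall>b \<in> hom C X (Dom C s). s \<cdot>\<^bsub>C\<^esub> a = s \<cdot>\<^bsub>C\<^esub> b \<longrightarrow> a = b)"

definition is_full :: "('o, 'a, 'm) ord_cat_scheme \<Rightarrow> 'a \<Rightarrow> bool" where
  "is_full C s \<longleftrightarrow> s \<in> Arr C \<and>
    (\<forall>X. \<forall>a \<in> hom C X (Dom C s). \<forall>b \<in> hom C X (Dom C s). s \<cdot>\<^bsub>C\<^esub> a \<sqsubseteq>\<^bsub>C\<^esub> s \<cdot>\<^bsub>C\<^esub> b \<longrightarrow> a \<sqsubseteq>\<^bsub>C\<^esub> b)"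

definition is_section :: "('o, 'a, 'm) ord_cat_scheme \<Rightarrow> 'a \<Rightarrow> bool" where
  "is_section C s \<longleftrightarrow> s \<in> Arr C \<and>
    (\<exists>r \<in> hom C (Cod C s) (Dom C s). r \<cdot>\<^bsub>C\<^esub> s = Id C (Dom C s))"

definition is_iso :: "('o, 'a, 'm) ord_cat_scheme \<Rightarrow> 'a \<Rightarrow> bool" where
  "is_iso C i \<longleftrightarrow> i \<in> Arr C \<and>
    (\<exists>j \<in> hom C (Cod C i) (Dom C i). j \<cdot>\<^bsub>C\<^esub> i = Id C (Dom C i) \<and> i \<cdot>\<^bsub>C\<^esub> j = Id C (Cod C i))"

text \<open>\<open>is_pullback C f g p q\<close>: the square \<open>f \<cdot> p = g \<cdot> q\<close> is a pullback. Thus \<open>p\<close> is the pullback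
  \<open>f\<^sup>*(g)\<close> of \<open>g\<close> along \<open>f\<close>, and \<open>q\<close> is \<open>g\<^sup>*(f)\<close>.\<close>

definition is_pullback :: "('o, 'a, 'm) ord_cat_scheme \<Rightarrow> 'a \<Rightarrow> 'a \<Rightarrow> 'a \<Rightarrow> 'a \<Rightarrow> bool" where
  "is_pullback C f g p q \<longleftrightarrow>
    f \<in> Arr C \<and> g \<in> Arr C \<and> Cod C f = Cod C g \<and>
    p \<in> hom C (Dom C p) (Dom C f) \<and> q \<in> hom C (Dom C p) (Dom C g) \<and>
    f \<cdot>\<^bsub>C\<^esub> p = g \<cdot>\<^bsub>C\<^esub> q \<and>
    (\<forall>X. \<forall>h \<in> hom C X (Dom C f). \<forall>k \<in> hom C X (Dom C g). f \<cdot>\<^bsub>C\<^esub> h = g \<cdot>\<^bsub>C\<^esub> k \<longrightarrow>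
      (\<exists>!u. u \<in> hom C X (Dom C p) \<and> p \<cdot>\<^bsub>C\<^esub> u = h \<and> q \<cdot>\<^bsub>C\<^esub> u = k))"

definition pullback_stable :: "('o, 'a, 'm) ord_cat_scheme \<Rightarrow> 'a set \<Rightarrow> 'a set \<Rightarrow> bool" where
  "pullback_stable C K T \<longleftrightarrow> (\<forall>k \<in> K. \<forall>t \<in> T. \<forall>p q. is_pullback C t k p q \<longrightarrow> p \<in> K)"


section \<open>Oplax weak factorisation systems\<close>

definition oplax_orth :: "('o, 'a, 'm) ord_cat_scheme \<Rightarrow> 'a \<Rightarrow> 'a \<Rightarrow> bool" where
  "oplax_orth C f g \<longleftrightarrow>
    (\<forall>u \<in> hom C (Dom C f) (Dom C g). \<forall>v \<in> hom C (Cod C f) (Cod C g).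
      v \<cdot>\<^bsub>C\<^esub> f \<sqsubseteq>\<^bsub>C\<^esub> g \<cdot>\<^bsub>C\<^esub> u \<longrightarrow>
      (\<exists>d \<in> hom C (Cod C f) (Dom C g). d \<cdot>\<^bsub>C\<^esub> f \<sqsubseteq>\<^bsub>C\<^esub> u \<and> v \<sqsubseteq>\<^bsub>C\<^esub> g \<cdot>\<^bsub>C\<^esub> d))"

locale oplax_wfs = ord_category C for C (structure) +
  fixes L R
  assumes right_class: "R = {g \<in> Arr C. \<forall>f \<in> L. oplax_orth C f g}"
    and left_class: "L = {f \<in> Arr C. \<forall>g \<in> R. oplax_orth C f g}"
    and factorisation: "f \<in> Arr C \<Longrightarrow> \<exists>l \<in> L. \<exists>r \<in> R. Cod C l = Dom C r \<and> f = r \<cdot> l"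


section \<open>Partial maps\<close>

locale subobject_class = ord_category C for C (structure) +
  fixes S
  assumes S_mono: "s \<in> S \<Longrightarrow> is_mono C s"
    and S_full: "s \<in> S \<Longrightarrow> is_full C s"
    and S_section: "is_section C s \<Longrightarrow> s \<in> S"
    and S_comp: "\<lbrakk>s \<in> S; t \<in> S; Cod C s = Dom C t\<rbrakk> \<Longrightarrow> t \<cdot> s \<in> S"
    and S_stable: "pullback_stable C S (Arr C)"
    and S_pullbacks: "\<lbrakk>f \<in> Arr C; s \<in> S; Cod C f = Cod C s\<rbrakk> \<Longrightarrow> \<exists>p q. is_pullback C f s p q"

definition spans :: "('o, 'a, 'm) ord_cat_scheme \<Rightarrow> 'a set \<Rightarrow> ('a \<times> 'a) set" where
  "spans C S = {(\<sigma>, \<phi>). \<sigma> \<in> S \<and> \<phi> \<in> Arr C \<and> Dom C \<phi> = Dom C \<sigma>}"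

definition span_iso :: "('o, 'a, 'm) ord_cat_scheme \<Rightarrow> 'a set \<Rightarrow> (('a \<times> 'a) \<times> ('a \<times> 'a)) set" where
  "span_iso C S = {((\<sigma>, \<phi>), (\<tau>, \<psi>)). (\<sigma>, \<phi>) \<in> spans C S \<and> (\<tau>, \<psi>) \<in> spans C S \<and>
    (\<exists>i \<in> hom C (Dom C \<tau>) (Dom C \<sigma>). is_iso C i \<and> \<tau> = \<sigma> \<cdot>\<^bsub>C\<^esub> i \<and> \<psi> = \<phi> \<cdot>\<^bsub>C\<^esub> i)}"

text \<open>Partial maps are isomorphism classes of spans. Source and target do not depend on the
  representative (lemmas \<open>Dom_Par\<close> and \<open>Cod_Par\<close> below). The composite collects the spans arising
  from all choices of representatives and of pullbacks; this is again one isomorphism class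
  (lemma \<open>Comp_Par\<close>).\<close>

definition Par :: "('o, 'a, 'm) ord_cat_scheme \<Rightarrow> 'a set \<Rightarrow> ('o, ('a \<times> 'a) set) ord_cat" where
  "Par C S = \<lparr>
    Obj = Obj C,
    Arr = spans C S // span_iso C S,
    Dom = (\<lambda>f. Cod C (fst (SOME x. x \<in> f))),
    Cod = (\<lambda>f. Cod C (snd (SOME x. x \<in> f))),
    Id = (\<lambda>A. span_iso C S `` {(Id C A, Id C A)}),
    Comp = (\<lambda>g f. {(\<sigma>\<^sub>f \<cdot>\<^bsub>C\<^esub> p, \<phi>\<^sub>g \<cdot>\<^bsub>C\<^esub> q) | \<sigma>\<^sub>f \<phi>\<^sub>f \<sigma>\<^sub>g \<phi>\<^sub>g p q.
      (\<sigma>\<^sub>f, \<phi>\<^sub>f) \<in> f \<and> (\<sigma>\<^sub>g, \<phi>\<^sub>g) \<in> g \<and> is_pullback C \<phi>\<^sub>f \<sigma>\<^sub>g p q}),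
    Le = (\<lambda>f g. \<exists>(\<sigma>\<^sub>f, \<phi>\<^sub>f) \<in> f. \<exists>(\<sigma>\<^sub>g, \<phi>\<^sub>g) \<in> g. \<exists>s \<in> S. s \<in> hom C (Dom C \<sigma>\<^sub>f) (Dom C \<sigma>\<^sub>g) \<and>
      \<sigma>\<^sub>f = \<sigma>\<^sub>g \<cdot>\<^bsub>C\<^esub> s \<and> \<phi>\<^sub>f \<sqsubseteq>\<^bsub>C\<^esub> \<phi>\<^sub>g \<cdot>\<^bsub>C\<^esub> s) \<rparr>"

text \<open>When \<open>K\<close> is closed under precomposition with isomorphisms, as both classes of an oplax weak
  factorisation system are, the choice of representative is immaterial.\<close>

definition Par_class :: "('o, 'a, 'm) ord_cat_scheme \<Rightarrow> 'a set \<Rightarrow> 'a set \<Rightarrow> ('a \<times> 'a) set set" where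
  "Par_class C S K = {f \<in> Arr (Par C S). \<exists>(\<sigma>, \<phi>) \<in> f. \<phi> \<in> K}"


subsection \<open>Partial maps form an Ord-enriched category\<close>

lemma (in category) homD:
  assumes "f \<in> hom C A B"
  shows "f \<in> Arr C" "Dom C f = A" "Cod C f = B" "A \<in> Obj C" "B \<in> Obj C"
  using assms Dom_in_Obj Cod_in_Obj by (auto simp: hom_def)

lemma (in category) ArrI: "f \<in> Arr C \<Longrightarrow> f \<in> hom C (Dom C f) (Cod C f)"
  by (auto simp: hom_def)

lemma is_pullback_sym:
  assumes "is_pullback C f g p q" shows "is_pullback C g f q p"
proof -
  from assms have "Dom C q = Dom C p" by (auto simp: is_pullback_def hom_def)
  with assms show ?thesis unfolding is_pullback_def
    by (auto simp: conj_commute)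
qed

lemma (in category) paste:
  assumes 1: "is_pullback C f g p q" and 2: "is_pullback C k p a b"
  shows "is_pullback C (f \<cdot> k) g a (q \<cdot> b)"
proof -
  obtain F where F: "f \<in> hom C (Dom C f) F" "g \<in> hom C (Dom C g) F"
    using 1 by (auto simp: is_pullback_def hom_def)
  have p: "p \<in> hom C (Dom C p) (Dom C f)" "q \<in> hom C (Dom C p) (Dom C g)" "f \<cdot> p = g \<cdot> q"
    using 1 by (auto simp: is_pullback_def)
  have k: "k \<in> hom C (Dom C k) (Dom C f)"
    using 2 p(1) by (auto simp: is_pullback_def hom_def)
  have a: "a \<in> hom C (Dom C a) (Dom C k)" "b \<in> hom C (Dom C a) (Dom C p)" "k \<cdot> a = p \<cdot> b"
    using 2 by (auto simp: is_pullback_def)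
  have fk: "f \<cdot> k \<in> hom C (Dom C k) F" using Comp_in_hom[OF k F(1)] .
  have qb: "q \<cdot> b \<in> hom C (Dom C a) (Dom C g)" using Comp_in_hom[OF a(2) p(2)] .
  have comm: "(f \<cdot> k) \<cdot> a = g \<cdot> (q \<cdot> b)"
    using Comp_assoc[OF a(1) k F(1)] Comp_assoc[OF a(2) p(1) F(1)] Comp_assoc[OF a(2) p(2) F(2)]
      a(3) p(3) by simp
  have univ: "\<exists>!u. u \<in> hom C X (Dom C a) \<and> a \<cdot> u = h \<and> (q \<cdot> b) \<cdot> u = l"
    if h: "h \<in> hom C X (Dom C k)" and l: "l \<in> hom C X (Dom C g)" and e: "(f \<cdot> k) \<cdot> h = g \<cdot> l"
    for X h l
  proof -
    have kh: "k \<cdot> h \<in> hom C X (Dom C f)" using Comp_in_hom[OF h k] .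
    have "f \<cdot> (k \<cdot> h) = g \<cdot> l" using e Comp_assoc[OF h k F(1)] by simp
    then obtain w where w: "w \<in> hom C X (Dom C p)" "p \<cdot> w = k \<cdot> h" "q \<cdot> w = l"
      and wu: "\<And>w'. \<lbrakk>w' \<in> hom C X (Dom C p); p \<cdot> w' = k \<cdot> h; q \<cdot> w' = l\<rbrakk> \<Longrightarrow> w' = w"
      using 1 kh l unfolding is_pullback_def by metis
    obtain u where u: "u \<in> hom C X (Dom C a)" "a \<cdot> u = h" "b \<cdot> u = w"
      and uu: "\<And>u'. \<lbrakk>u' \<in> hom C X (Dom C a); a \<cdot> u' = h; b \<cdot> u' = w\<rbrakk> \<Longrightarrow> u' = u"
      using 2 h w(1) w(2)[symmetric] unfolding is_pullback_def by metis
    show ?thesis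
    proof (rule ex1I[of _ u])
      show "u \<in> hom C X (Dom C a) \<and> a \<cdot> u = h \<and> (q \<cdot> b) \<cdot> u = l"
        using u w Comp_assoc[OF u(1) a(2) p(2)] by simp
    next
      fix u' assume u': "u' \<in> hom C X (Dom C a) \<and> a \<cdot> u' = h \<and> (q \<cdot> b) \<cdot> u' = l"
      then have u1: "u' \<in> hom C X (Dom C a)" by simp
      have "b \<cdot> u' = w"
      proof (rule wu)
        show "b \<cdot> u' \<in> hom C X (Dom C p)" using Comp_in_hom[OF u1 a(2)] .
        show "p \<cdot> (b \<cdot> u') = k \<cdot> h"
          using Comp_assoc[OF u1 a(2) p(1)] Comp_assoc[OF u1 a(1) k] a(3) u' by simp
        show "q \<cdot> (b \<cdot> u') = l" using Comp_assoc[OF u1 a(2) p(2)] u' by simp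
      qed
      then show "u' = u" using uu u' by blast
    qed
  qed
  show ?thesis unfolding is_pullback_def
    using fk F(2) a(1) qb comm univ homD[OF fk] homD[OF F(2)] by auto
qed

lemma (in category) Id_iso: "A \<in> Obj C \<Longrightarrow> is_iso C (Id C A)"
  using Id_in_hom[of A] Comp_Id[OF Id_in_hom, of A] homD[OF Id_in_hom, of A]
  by (auto simp: is_iso_def)

lemma (in category) isoE:
  assumes "is_iso C i" "i \<in> hom C A B"
  obtains j where "j \<in> hom C B A" "j \<cdot> i = Id C A" "i \<cdot> j = Id C B" "is_iso C j"
  using assms by (auto simp: is_iso_def hom_def)

lemma (in category) iso_comp:
  assumes "is_iso C i" "i \<in> hom C A B" "is_iso C k" "k \<in> hom C B D"
  shows "is_iso C (k \<cdot> i)"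
proof -
  obtain j where j: "j \<in> hom C B A" "j \<cdot> i = Id C A" "i \<cdot> j = Id C B" using assms isoE by blast
  obtain l where l: "l \<in> hom C D B" "l \<cdot> k = Id C B" "k \<cdot> l = Id C D" using assms isoE by blast
  have ki: "k \<cdot> i \<in> hom C A D" and jl: "j \<cdot> l \<in> hom C D A"
    using Comp_in_hom assms j l by blast+
  have "(j \<cdot> l) \<cdot> (k \<cdot> i) = Id C A"
    using Comp_assoc[OF ki l(1) j(1)] Comp_assoc[OF assms(2,4) l(1)] j l Id_Comp assms by metis
  moreover have "(k \<cdot> i) \<cdot> (j \<cdot> l) = Id C D"
    using Comp_assoc[OF jl assms(2,4)] Comp_assoc[OF l(1) j(1) assms(2)] j l Id_Comp assms by metis
  ultimately show ?thesis using ki jl homD[OF ki] by (auto simp: is_iso_def)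
qed

text \<open>Pulling back along an isomorphism, and uniqueness of pullbacks.\<close>

lemma (in category) iso_pullback:
  assumes i: "is_iso C i" "i \<in> hom C A B" and p: "p \<in> hom C X B"
    and j: "j \<in> hom C B A" "j \<cdot> i = Id C A" "i \<cdot> j = Id C B"
  shows "is_pullback C i p (j \<cdot> p) (Id C X)"
proof -
  have jp: "j \<cdot> p \<in> hom C X A" using Comp_in_hom[OF p j(1)] .
  have I: "Id C X \<in> hom C X X" using Id_in_hom homD(4)[OF p] by blast
  have comm: "i \<cdot> (j \<cdot> p) = p \<cdot> Id C X"
    using Comp_assoc[OF p j(1) i(2)] j Id_Comp[OF p] Comp_Id[OF p] by simp
  have "\<exists>!u. u \<in> hom C Y X \<and> (j \<cdot> p) \<cdot> u = h \<and> Id C X \<cdot> u = k"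
    if h: "h \<in> hom C Y A" and k: "k \<in> hom C Y X" and e: "i \<cdot> h = p \<cdot> k" for Y h k
  proof (rule ex1I[of _ k])
    have "(j \<cdot> p) \<cdot> k = j \<cdot> (i \<cdot> h)" using Comp_assoc[OF k p j(1)] e by simp
    also have "\<dots> = h" using Comp_assoc[OF h i(2) j(1)] j Id_Comp[OF h] by simp
    finally show "k \<in> hom C Y X \<and> (j \<cdot> p) \<cdot> k = h \<and> Id C X \<cdot> k = k"
      using k Id_Comp by simp
  qed (use Id_Comp in auto)
  then show ?thesis unfolding is_pullback_def
    using homD[OF i(2)] homD[OF p] homD[OF jp] jp I comm by auto
qed

lemma (in category) pullback_unique:
  assumes 1: "is_pullback C f g p q" and 2: "is_pullback C f g p' q'"
  shows "\<exists>i \<in> hom C (Dom C p') (Dom C p). is_iso C i \<and> p' = p \<cdot> i \<and> q' = q \<cdot> i"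
proof -
  have p: "p \<in> hom C (Dom C p) (Dom C f)" "q \<in> hom C (Dom C p) (Dom C g)" "f \<cdot> p = g \<cdot> q"
    using 1 by (auto simp: is_pullback_def)
  have p': "p' \<in> hom C (Dom C p') (Dom C f)" "q' \<in> hom C (Dom C p') (Dom C g)" "f \<cdot> p' = g \<cdot> q'"
    using 2 by (auto simp: is_pullback_def)
  obtain i where i: "i \<in> hom C (Dom C p') (Dom C p)" "p \<cdot> i = p'" "q \<cdot> i = q'"
    using 1 p' unfolding is_pullback_def by metis
  obtain j where j: "j \<in> hom C (Dom C p) (Dom C p')" "p' \<cdot> j = p" "q' \<cdot> j = q"
    using 2 p unfolding is_pullback_def by metis
  have uniq: "u = v" if "is_pullback C f g a b" "u \<in> hom C (Dom C a) (Dom C a)"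
    "v \<in> hom C (Dom C a) (Dom C a)"
    "a \<cdot> u = a" "b \<cdot> u = b" "a \<cdot> v = a" "b \<cdot> v = b" for a b u v
    using that unfolding is_pullback_def by metis
  have I: "Id C (Dom C p) \<in> hom C (Dom C p) (Dom C p)"
    "Id C (Dom C p') \<in> hom C (Dom C p') (Dom C p')"
    using Id_in_hom homD(4)[OF p(1)] homD(4)[OF p'(1)] by blast+
  have "i \<cdot> j = Id C (Dom C p)"
    by (rule uniq[OF 1 Comp_in_hom[OF j(1) i(1)] I(1)])
      (use Comp_assoc[OF j(1) i(1) p(1)] Comp_assoc[OF j(1) i(1) p(2)] i j
        Comp_Id[OF p(1)] Comp_Id[OF p(2)] in simp_all)
  moreover have "j \<cdot> i = Id C (Dom C p')"
    by (rule uniq[OF 2 Comp_in_hom[OF i(1) j(1)] I(2)])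
      (use Comp_assoc[OF i(1) j(1) p'(1)] Comp_assoc[OF i(1) j(1) p'(2)] i j
        Comp_Id[OF p'(1)] Comp_Id[OF p'(2)] in simp_all)
  ultimately have "is_iso C i" using i(1) j(1) homD[OF i(1)] by (auto simp: is_iso_def)
  then show ?thesis using i by auto
qed

lemma (in category) pullback_iso:
  assumes 1: "is_pullback C f g p q" and i: "is_iso C i" "i \<in> hom C X (Dom C p)"
  shows "is_pullback C f g (p \<cdot> i) (q \<cdot> i)"
proof -
  have p: "p \<in> hom C (Dom C p) (Dom C f)" "q \<in> hom C (Dom C p) (Dom C g)" "f \<cdot> p = g \<cdot> q"
    using 1 by (auto simp: is_pullback_def)
  obtain F where F: "f \<in> hom C (Dom C f) F" "g \<in> hom C (Dom C g) F"
    using 1 by (auto simp: is_pullback_def hom_def)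
  obtain j where j: "j \<in> hom C (Dom C p) X" "j \<cdot> i = Id C X" "i \<cdot> j = Id C (Dom C p)" "is_iso C j"
    using isoE[OF i] by blast
  have "is_pullback C (Id C (Dom C f)) p (p \<cdot> i) i"
  proof -
    have I: "Id C (Dom C f) \<in> hom C (Dom C f) (Dom C f)" using Id_in_hom homD(5)[OF p(1)] by blast
    have pi: "p \<cdot> i \<in> hom C X (Dom C f)" using Comp_in_hom[OF i(2) p(1)] .
    have "\<exists>!u. u \<in> hom C Y X \<and> (p \<cdot> i) \<cdot> u = h \<and> i \<cdot> u = k"
      if h: "h \<in> hom C Y (Dom C f)" and k: "k \<in> hom C Y (Dom C p)"
        and e: "Id C (Dom C f) \<cdot> h = p \<cdot> k" for Y h k
    proof (rule ex1I[of _ "j \<cdot> k"])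
      have jk: "j \<cdot> k \<in> hom C Y X" using Comp_in_hom[OF k j(1)] .
      have ijk: "i \<cdot> (j \<cdot> k) = k" using Comp_assoc[OF k j(1) i(2)] j Id_Comp[OF k] by simp
      have "(p \<cdot> i) \<cdot> (j \<cdot> k) = h"
        using Comp_assoc[OF jk i(2) p(1)] ijk e Id_Comp[OF h] by simp
      then show "j \<cdot> k \<in> hom C Y X \<and> (p \<cdot> i) \<cdot> (j \<cdot> k) = h \<and> i \<cdot> (j \<cdot> k) = k"
        using jk ijk by simp
    next
      fix u assume u: "u \<in> hom C Y X \<and> (p \<cdot> i) \<cdot> u = h \<and> i \<cdot> u = k"
      then have "j \<cdot> k = (j \<cdot> i) \<cdot> u" using Comp_assoc[OF _ i(2) j(1), of u Y] by auto
      then show "u = j \<cdot> k" using j u Id_Comp by auto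
    qed
    then show ?thesis unfolding is_pullback_def
      using homD[OF I] homD[OF p(1)] homD[OF pi] I pi p i Id_Comp[OF pi] by auto
  qed
  from paste[OF 1 this] show ?thesis using Comp_Id[OF F(1)] by simp
qed

lemma (in category) pullback_along_Id:
  assumes p: "p \<in> hom C X B" shows "is_pullback C (Id C B) p p (Id C X)"
proof -
  have B: "B \<in> Obj C" using homD(5)[OF p] .
  have "is_pullback C (Id C B) p (Id C B \<cdot> p) (Id C X)"
    by (rule iso_pullback[OF Id_iso[OF B] Id_in_hom[OF B] p Id_in_hom[OF B]])
      (use Id_Comp[OF Id_in_hom[OF B]] in auto)
  then show ?thesis using Id_Comp[OF p] by simp
qed

text \<open>Replacing a cospan by an isomorphic one.\<close>

lemma (in category) pullback_cospan_iso:
  assumes 1: "is_pullback C (f \<cdot> i) g p q" and i: "is_iso C i" "i \<in> hom C X (Dom C f)"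
    and f: "f \<in> Arr C"
  shows "is_pullback C f g (i \<cdot> p) q"
proof -
  obtain j where j: "j \<in> hom C (Dom C f) X" "j \<cdot> i = Id C X" "i \<cdot> j = Id C (Dom C f)" "is_iso C j"
    using isoE[OF i] by blast
  have fi: "f \<cdot> i \<in> hom C X (Cod C f)" using Comp_in_hom[OF i(2) ArrI[OF f]] .
  have p: "p \<in> hom C (Dom C p) X" using 1 homD[OF fi] by (auto simp: is_pullback_def)
  have q: "q \<in> hom C (Dom C p) (Dom C g)" using 1 by (auto simp: is_pullback_def)
  have "is_pullback C j p (i \<cdot> p) (Id C (Dom C p))"
    by (rule iso_pullback[OF j(4,1) p i(2) j(3,2)])
  from paste[OF 1 this]
  have "is_pullback C ((f \<cdot> i) \<cdot> j) g (i \<cdot> p) (q \<cdot> Id C (Dom C p))" .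
  moreover have "(f \<cdot> i) \<cdot> j = f"
    using Comp_assoc[OF j(1) i(2) ArrI[OF f]] j Comp_Id[OF ArrI[OF f]] by simp
  ultimately show ?thesis using Comp_Id[OF q] by simp
qed

context subobject_class
begin

lemma S_Arr: "s \<in> S \<Longrightarrow> s \<in> Arr C"
  using S_mono by (auto simp: is_mono_def)

lemma S_monoD:
  "\<lbrakk>s \<in> S; a \<in> hom C X (Dom C s); b \<in> hom C X (Dom C s); s \<cdot> a = s \<cdot> b\<rbrakk> \<Longrightarrow> a = b"
  using S_mono unfolding is_mono_def by blast

lemma S_iso: "is_iso C i \<Longrightarrow> i \<in> S"
  by (rule S_section) (auto simp: is_iso_def is_section_def)

lemma S_pullback: "is_pullback C f s p q \<Longrightarrow> s \<in> S \<Longrightarrow> p \<in> S"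
  using S_stable unfolding pullback_stable_def by (auto simp: is_pullback_def)

lemma spansD:
  assumes "(\<sigma>, \<phi>) \<in> spans C S"
  shows "\<sigma> \<in> S" "\<sigma> \<in> hom C (Dom C \<sigma>) (Cod C \<sigma>)" "\<phi> \<in> hom C (Dom C \<sigma>) (Cod C \<phi>)"
    "\<phi> \<in> Arr C" "Dom C \<phi> = Dom C \<sigma>"
  using assms S_Arr by (auto simp: spans_def hom_def)

lemma spansI: "\<sigma> \<in> S \<Longrightarrow> \<sigma> \<in> hom C D A \<Longrightarrow> \<phi> \<in> hom C D B \<Longrightarrow> (\<sigma>, \<phi>) \<in> spans C S"
  by (auto simp: spans_def hom_def)

abbreviation cls where "cls \<sigma> \<phi> \<equiv> span_iso C S `` {(\<sigma>, \<phi>)}"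

lemma mem_cls:
  assumes "(\<sigma>, \<phi>) \<in> spans C S"
  shows "(\<tau>, \<psi>) \<in> cls \<sigma> \<phi> \<longleftrightarrow>
    (\<exists>X. \<exists>i \<in> hom C X (Dom C \<sigma>). is_iso C i \<and> \<tau> = \<sigma> \<cdot> i \<and> \<psi> = \<phi> \<cdot> i)"
proof
  assume "(\<tau>, \<psi>) \<in> cls \<sigma> \<phi>"
  then show "\<exists>X. \<exists>i \<in> hom C X (Dom C \<sigma>). is_iso C i \<and> \<tau> = \<sigma> \<cdot> i \<and> \<psi> = \<phi> \<cdot> i"
    by (auto simp: span_iso_def)
next
  assume "\<exists>X. \<exists>i \<in> hom C X (Dom C \<sigma>). is_iso C i \<and> \<tau> = \<sigma> \<cdot> i \<and> \<psi> = \<phi> \<cdot> i"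
  then obtain X i where i: "i \<in> hom C X (Dom C \<sigma>)" "is_iso C i" "\<tau> = \<sigma> \<cdot> i" "\<psi> = \<phi> \<cdot> i"
    by blast
  note s = spansD[OF assms]
  have h: "\<tau> \<in> hom C X (Cod C \<sigma>)" "\<psi> \<in> hom C X (Cod C \<phi>)"
    using Comp_in_hom[OF i(1) s(2)] Comp_in_hom[OF i(1) s(3)] i by auto
  have "\<tau> \<in> S" using S_comp[OF S_iso[OF i(2)] s(1)] homD[OF i(1)] i by simp
  then have "(\<tau>, \<psi>) \<in> spans C S" using spansI h by blast
  then show "(\<tau>, \<psi>) \<in> cls \<sigma> \<phi>" using i assms homD[OF h(1)] by (auto simp: span_iso_def)
qed

lemma span_iso_equiv: "equiv (spans C S) (span_iso C S)"
proof (rule equivI)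
  show "span_iso C S \<subseteq> spans C S \<times> spans C S" by (auto simp: span_iso_def)
  show "refl_on (spans C S) (span_iso C S)"
  proof (rule refl_onI)
    fix x assume x: "x \<in> spans C S"
    obtain \<sigma> \<phi> where [simp]: "x = (\<sigma>, \<phi>)" by (cases x)
    note s = spansD[OF x[simplified]]
    have "Id C (Dom C \<sigma>) \<in> hom C (Dom C \<sigma>) (Dom C \<sigma>)" "is_iso C (Id C (Dom C \<sigma>))"
      using Id_in_hom Id_iso homD(4)[OF s(2)] by blast+
    then show "(x, x) \<in> span_iso C S"
      using x Comp_Id[OF s(2)] Comp_Id[OF s(3)] by (force simp: span_iso_def)
  qed
  show "sym (span_iso C S)"
  proof (rule symI)
    fix x y assume xy: "(x, y) \<in> span_iso C S"
    obtain \<sigma> \<phi> \<tau> \<psi> where [simp]: "x = (\<sigma>, \<phi>)" "y = (\<tau>, \<psi>)" by (cases x, cases y)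
    from xy obtain i where sp: "(\<sigma>, \<phi>) \<in> spans C S" "(\<tau>, \<psi>) \<in> spans C S"
      and i: "i \<in> hom C (Dom C \<tau>) (Dom C \<sigma>)" "is_iso C i" "\<tau> = \<sigma> \<cdot> i" "\<psi> = \<phi> \<cdot> i"
      by (auto simp: span_iso_def)
    obtain j where j: "j \<in> hom C (Dom C \<sigma>) (Dom C \<tau>)" "i \<cdot> j = Id C (Dom C \<sigma>)" "is_iso C j"
      using isoE[OF i(2,1)] by metis
    have "\<sigma> = \<tau> \<cdot> j" "\<phi> = \<psi> \<cdot> j"
      using Comp_assoc[OF j(1) i(1) spansD(2)[OF sp(1)]] Comp_assoc[OF j(1) i(1) spansD(3)[OF sp(1)]]
        i j Comp_Id[OF spansD(2)[OF sp(1)]] Comp_Id[OF spansD(3)[OF sp(1)]] by simp_all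
    then show "(y, x) \<in> span_iso C S" using sp j by (auto simp: span_iso_def)
  qed
  show "trans (span_iso C S)"
  proof (rule transI)
    fix x y z assume xy: "(x, y) \<in> span_iso C S" and yz: "(y, z) \<in> span_iso C S"
    obtain \<sigma> \<phi> \<tau> \<psi> \<rho> \<chi> where [simp]: "x = (\<sigma>, \<phi>)" "y = (\<tau>, \<psi>)" "z = (\<rho>, \<chi>)"
      by (cases x, cases y, cases z)
    from xy obtain i where sp: "(\<sigma>, \<phi>) \<in> spans C S" "(\<tau>, \<psi>) \<in> spans C S"
      and i: "i \<in> hom C (Dom C \<tau>) (Dom C \<sigma>)" "is_iso C i" "\<tau> = \<sigma> \<cdot> i" "\<psi> = \<phi> \<cdot> i"
      by (auto simp: span_iso_def)
    from yz obtain j where sp2: "(\<rho>, \<chi>) \<in> spans C S"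
      and j: "j \<in> hom C (Dom C \<rho>) (Dom C \<tau>)" "is_iso C j" "\<rho> = \<tau> \<cdot> j" "\<chi> = \<psi> \<cdot> j"
      by (auto simp: span_iso_def)
    have "\<rho> = \<sigma> \<cdot> (i \<cdot> j)" "\<chi> = \<phi> \<cdot> (i \<cdot> j)"
      using Comp_assoc[OF j(1) i(1) spansD(2)[OF sp(1)]] Comp_assoc[OF j(1) i(1) spansD(3)[OF sp(1)]]
        i j by simp_all
    moreover have "i \<cdot> j \<in> hom C (Dom C \<rho>) (Dom C \<sigma>)" "is_iso C (i \<cdot> j)"
      using Comp_in_hom[OF j(1) i(1)] iso_comp[OF j(2,1) i(2,1)] by auto
    ultimately show "(x, z) \<in> span_iso C S" using sp sp2 by (auto simp: span_iso_def)
  qed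
qed

lemma cls_self: "(\<sigma>, \<phi>) \<in> spans C S \<Longrightarrow> (\<sigma>, \<phi>) \<in> cls \<sigma> \<phi>"
  using equiv_class_self[OF span_iso_equiv] .

lemma cls_eqI: "(\<sigma>, \<phi>) \<in> spans C S \<Longrightarrow> (\<tau>, \<psi>) \<in> cls \<sigma> \<phi> \<Longrightarrow> cls \<tau> \<psi> = cls \<sigma> \<phi>"
  using equiv_class_eq[OF span_iso_equiv, of "(\<sigma>, \<phi>)" "(\<tau>, \<psi>)"] by auto

lemma Arr_ParI: "(\<sigma>, \<phi>) \<in> spans C S \<Longrightarrow> cls \<sigma> \<phi> \<in> Arr (Par C S)"
  by (auto simp: Par_def intro: quotientI)

lemma mem_cls_Cod:
  assumes "(\<sigma>, \<phi>) \<in> spans C S" "(\<tau>, \<psi>) \<in> cls \<sigma> \<phi>"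
  shows "Cod C \<tau> = Cod C \<sigma>" "Cod C \<psi> = Cod C \<phi>"
proof -
  obtain X i where i: "i \<in> hom C X (Dom C \<sigma>)" "\<tau> = \<sigma> \<cdot> i" "\<psi> = \<phi> \<cdot> i"
    using assms mem_cls by blast
  show "Cod C \<tau> = Cod C \<sigma>" "Cod C \<psi> = Cod C \<phi>"
    using homD(3)[OF Comp_in_hom[OF i(1) spansD(2)[OF assms(1)]]]
      homD(3)[OF Comp_in_hom[OF i(1) spansD(3)[OF assms(1)]]] i by auto
qed

lemma some_cls:
  assumes "(\<sigma>, \<phi>) \<in> spans C S"
  obtains \<tau> \<psi> where "(SOME x. x \<in> cls \<sigma> \<phi>) = (\<tau>, \<psi>)" "(\<tau>, \<psi>) \<in> cls \<sigma> \<phi>"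
  using someI[of "\<lambda>x. x \<in> cls \<sigma> \<phi>", OF cls_self[OF assms]] by (metis surj_pair)

lemma Dom_Par: "(\<sigma>, \<phi>) \<in> spans C S \<Longrightarrow> Dom (Par C S) (cls \<sigma> \<phi>) = Cod C \<sigma>"
  by (rule some_cls, assumption) (simp add: Par_def mem_cls_Cod)

lemma Cod_Par: "(\<sigma>, \<phi>) \<in> spans C S \<Longrightarrow> Cod (Par C S) (cls \<sigma> \<phi>) = Cod C \<phi>"
  by (rule some_cls, assumption) (simp add: Par_def mem_cls_Cod)

lemma hom_Par_iff:
  "f \<in> hom (Par C S) A B \<longleftrightarrow>
    (\<exists>\<sigma> \<phi> D. \<sigma> \<in> S \<and> \<sigma> \<in> hom C D A \<and> \<phi> \<in> hom C D B \<and> f = cls \<sigma> \<phi>)"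
proof
  assume f: "f \<in> hom (Par C S) A B"
  then have "f \<in> spans C S // span_iso C S" by (simp add: hom_def Par_def)
  then obtain \<sigma> \<phi> where s: "(\<sigma>, \<phi>) \<in> spans C S" "f = cls \<sigma> \<phi>"
    by (metis quotientE surj_pair)
  with f have "Cod C \<sigma> = A" "Cod C \<phi> = B" using Dom_Par Cod_Par by (auto simp: hom_def)
  then show "\<exists>\<sigma> \<phi> D. \<sigma> \<in> S \<and> \<sigma> \<in> hom C D A \<and> \<phi> \<in> hom C D B \<and> f = cls \<sigma> \<phi>"
    using spansD[OF s(1)] s by blast
next
  assume "\<exists>\<sigma> \<phi> D. \<sigma> \<in> S \<and> \<sigma> \<in> hom C D A \<and> \<phi> \<in> hom C D B \<and> f = cls \<sigma> \<phi>"
  then obtain \<sigma> \<phi> D where s: "\<sigma> \<in> S" "\<sigma> \<in> hom C D A" "\<phi> \<in> hom C D B" "f = cls \<sigma> \<phi>" by blast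
  then have "(\<sigma>, \<phi>) \<in> spans C S" using spansI by blast
  then show "f \<in> hom (Par C S) A B"
    using Arr_ParI Dom_Par Cod_Par s homD[OF s(2)] homD[OF s(3)] by (auto simp: hom_def)
qed

lemma mem_Comp_Par:
  "(\<alpha>, \<beta>) \<in> Comp (Par C S) g f \<longleftrightarrow>
    (\<exists>\<sigma> \<phi> \<tau> \<psi> p q. \<alpha> = \<sigma> \<cdot> p \<and> \<beta> = \<psi> \<cdot> q \<and> (\<sigma>, \<phi>) \<in> f \<and> (\<tau>, \<psi>) \<in> g \<and> is_pullback C \<phi> \<tau> p q)"
  by (simp add: Par_def)

lemma Le_Par_rep:
  "Le (Par C S) f g \<longleftrightarrow>
    (\<exists>\<sigma> \<phi> \<tau> \<psi> s. (\<sigma>, \<phi>) \<in> f \<and> (\<tau>, \<psi>) \<in> g \<and> s \<in> S \<and> s \<in> hom C (Dom C \<sigma>) (Dom C \<tau>) \<and>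
      \<sigma> = \<tau> \<cdot> s \<and> \<phi> \<sqsubseteq> \<psi> \<cdot> s)"
  by (simp add: Par_def) fast

lemma Comp_Par:
  assumes 1: "(\<sigma>, \<phi>) \<in> spans C S" and 2: "(\<tau>, \<psi>) \<in> spans C S" and pb: "is_pullback C \<phi> \<tau> p q"
  shows "Comp (Par C S) (cls \<tau> \<psi>) (cls \<sigma> \<phi>) = cls (\<sigma> \<cdot> p) (\<psi> \<cdot> q)"
    "(\<sigma> \<cdot> p, \<psi> \<cdot> q) \<in> spans C S"
proof -
  note s = spansD[OF 1] and t = spansD[OF 2]
  have p: "p \<in> hom C (Dom C p) (Dom C \<sigma>)" and q: "q \<in> hom C (Dom C p) (Dom C \<tau>)"
    using pb s(5) by (auto simp: is_pullback_def)
  have "\<sigma> \<cdot> p \<in> S" using S_comp[OF S_pullback[OF pb t(1)] s(1)] homD[OF p] by simp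
  then show sp: "(\<sigma> \<cdot> p, \<psi> \<cdot> q) \<in> spans C S"
    using spansI Comp_in_hom[OF p s(2)] Comp_in_hom[OF q t(3)] by blast
  have dom: "Dom C (\<sigma> \<cdot> p) = Dom C p" using homD[OF Comp_in_hom[OF p s(2)]] by simp
  have "(\<alpha>, \<beta>) \<in> Comp (Par C S) (cls \<tau> \<psi>) (cls \<sigma> \<phi>) \<longleftrightarrow> (\<alpha>, \<beta>) \<in> cls (\<sigma> \<cdot> p) (\<psi> \<cdot> q)" for \<alpha> \<beta>
  proof
    assume "(\<alpha>, \<beta>) \<in> Comp (Par C S) (cls \<tau> \<psi>) (cls \<sigma> \<phi>)"
    then obtain \<sigma>' \<phi>' \<tau>' \<psi>' p' q' where
      m: "(\<sigma>', \<phi>') \<in> cls \<sigma> \<phi>" "(\<tau>', \<psi>') \<in> cls \<tau> \<psi>" and pb': "is_pullback C \<phi>' \<tau>' p' q'"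
      and ab: "\<alpha> = \<sigma>' \<cdot> p'" "\<beta> = \<psi>' \<cdot> q'"
      unfolding mem_Comp_Par by blast
    obtain X i where i: "i \<in> hom C X (Dom C \<sigma>)" "is_iso C i" "\<sigma>' = \<sigma> \<cdot> i" "\<phi>' = \<phi> \<cdot> i"
      using m(1) mem_cls[OF 1] by blast
    obtain Y j where j: "j \<in> hom C Y (Dom C \<tau>)" "is_iso C j" "\<tau>' = \<tau> \<cdot> j" "\<psi>' = \<psi> \<cdot> j"
      using m(2) mem_cls[OF 2] by blast
    have "is_pullback C \<phi> \<tau>' (i \<cdot> p') q'"
      using pullback_cospan_iso[of \<phi> i \<tau>' p' q' X] pb' i s by simp
    then have "is_pullback C \<tau> \<phi> (j \<cdot> q') (i \<cdot> p')"
      using pullback_cospan_iso[of \<tau> j \<phi> q' "i \<cdot> p'" Y] is_pullback_sym j t S_Arr by metis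
    then have "is_pullback C \<phi> \<tau> (i \<cdot> p') (j \<cdot> q')" by (rule is_pullback_sym)
    from pullback_unique[OF pb this] obtain k where
      k: "k \<in> hom C (Dom C (i \<cdot> p')) (Dom C p)" "is_iso C k" "i \<cdot> p' = p \<cdot> k" "j \<cdot> q' = q \<cdot> k" by blast
    have h': "\<sigma>' \<in> hom C X (Cod C \<sigma>)" "\<phi>' \<in> hom C X (Cod C \<phi>)" "\<tau>' \<in> hom C Y (Cod C \<tau>)"
      using Comp_in_hom[OF i(1) s(2)] Comp_in_hom[OF i(1) s(3)] Comp_in_hom[OF j(1) t(2)] i j by auto
    have p': "p' \<in> hom C (Dom C p') X" and q': "q' \<in> hom C (Dom C p') Y"
      using pb' homD[OF h'(2)] homD[OF h'(3)] by (auto simp: is_pullback_def)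
    have "\<alpha> = (\<sigma> \<cdot> p) \<cdot> k" "\<beta> = (\<psi> \<cdot> q) \<cdot> k"
      using ab i j k Comp_assoc[OF p' i(1) s(2)] Comp_assoc[OF q' j(1) t(3)]
        Comp_assoc[OF k(1) p s(2)] Comp_assoc[OF k(1) q t(3)] by simp_all
    then show "(\<alpha>, \<beta>) \<in> cls (\<sigma> \<cdot> p) (\<psi> \<cdot> q)" using mem_cls[OF sp] k dom by metis
  next
    assume "(\<alpha>, \<beta>) \<in> cls (\<sigma> \<cdot> p) (\<psi> \<cdot> q)"
    then obtain X k where k: "k \<in> hom C X (Dom C p)" "is_iso C k"
      "\<alpha> = (\<sigma> \<cdot> p) \<cdot> k" "\<beta> = (\<psi> \<cdot> q) \<cdot> k"
      using mem_cls[OF sp] dom by metis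
    have "is_pullback C \<phi> \<tau> (p \<cdot> k) (q \<cdot> k)" using pullback_iso[OF pb k(2,1)] .
    moreover have "\<alpha> = \<sigma> \<cdot> (p \<cdot> k)" "\<beta> = \<psi> \<cdot> (q \<cdot> k)"
      using k Comp_assoc[OF k(1) p s(2)] Comp_assoc[OF k(1) q t(3)] by simp_all
    ultimately show "(\<alpha>, \<beta>) \<in> Comp (Par C S) (cls \<tau> \<psi>) (cls \<sigma> \<phi>)"
      unfolding mem_Comp_Par using cls_self[OF 1] cls_self[OF 2] by blast
  qed
  then show "Comp (Par C S) (cls \<tau> \<psi>) (cls \<sigma> \<phi>) = cls (\<sigma> \<cdot> p) (\<psi> \<cdot> q)" by auto
qed

lemma Le_Par:
  assumes 1: "(\<sigma>, \<phi>) \<in> spans C S" and 2: "(\<tau>, \<psi>) \<in> spans C S" and e: "Cod C \<phi> = Cod C \<psi>"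
  shows "Le (Par C S) (cls \<sigma> \<phi>) (cls \<tau> \<psi>) \<longleftrightarrow>
    (\<exists>s \<in> S. s \<in> hom C (Dom C \<sigma>) (Dom C \<tau>) \<and> \<sigma> = \<tau> \<cdot> s \<and> \<phi> \<sqsubseteq> \<psi> \<cdot> s)"
proof
  assume "\<exists>s \<in> S. s \<in> hom C (Dom C \<sigma>) (Dom C \<tau>) \<and> \<sigma> = \<tau> \<cdot> s \<and> \<phi> \<sqsubseteq> \<psi> \<cdot> s"
  then show "Le (Par C S) (cls \<sigma> \<phi>) (cls \<tau> \<psi>)"
    unfolding Le_Par_rep using cls_self[OF 1] cls_self[OF 2] by blast
next
  note sp = spansD[OF 1] and t = spansD[OF 2]
  assume "Le (Par C S) (cls \<sigma> \<phi>) (cls \<tau> \<psi>)"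
  then obtain \<sigma>' \<phi>' \<tau>' \<psi>' s where
    m: "(\<sigma>', \<phi>') \<in> cls \<sigma> \<phi>" "(\<tau>', \<psi>') \<in> cls \<tau> \<psi>"
    and s: "s \<in> S" "s \<in> hom C (Dom C \<sigma>') (Dom C \<tau>')" "\<sigma>' = \<tau>' \<cdot> s" "\<phi>' \<sqsubseteq> \<psi>' \<cdot> s"
    unfolding Le_Par_rep by blast
  obtain X i where i: "i \<in> hom C X (Dom C \<sigma>)" "is_iso C i" "\<sigma>' = \<sigma> \<cdot> i" "\<phi>' = \<phi> \<cdot> i"
    using m(1) mem_cls[OF 1] by blast
  obtain Y j where j: "j \<in> hom C Y (Dom C \<tau>)" "is_iso C j" "\<tau>' = \<tau> \<cdot> j" "\<psi>' = \<psi> \<cdot> j"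
    using m(2) mem_cls[OF 2] by blast
  obtain i' where i': "i' \<in> hom C (Dom C \<sigma>) X" "i \<cdot> i' = Id C (Dom C \<sigma>)" "is_iso C i'"
    using isoE[OF i(2,1)] by metis
  have h: "\<sigma>' \<in> hom C X (Cod C \<sigma>)" "\<tau>' \<in> hom C Y (Cod C \<tau>)" "\<psi>' \<in> hom C Y (Cod C \<psi>)"
      "\<phi>' \<in> hom C X (Cod C \<psi>)"
    using Comp_in_hom[OF i(1) sp(2)] Comp_in_hom[OF j(1) t(2)] Comp_in_hom[OF j(1) t(3)]
      Comp_in_hom[OF i(1) sp(3)] i j e by auto
  have s': "s \<in> hom C X Y" using s(2) homD[OF h(1)] homD[OF h(2)] by simp
  have si: "s \<cdot> i' \<in> hom C (Dom C \<sigma>) Y" using Comp_in_hom[OF i'(1) s'] .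
  define r where "r = j \<cdot> (s \<cdot> i')"
  have r: "r \<in> hom C (Dom C \<sigma>) (Dom C \<tau>)" unfolding r_def using Comp_in_hom[OF si j(1)] .
  have "s \<cdot> i' \<in> S" using S_comp[OF S_iso[OF i'(3)] s(1)] homD[OF i'(1)] homD[OF s'] by simp
  then have "r \<in> S" unfolding r_def
    using S_comp[OF _ S_iso[OF j(2)]] homD[OF si] homD[OF j(1)] by simp
  moreover have "\<sigma> = \<tau> \<cdot> r"
  proof -
    have "\<tau> \<cdot> r = \<tau>' \<cdot> (s \<cdot> i')" unfolding r_def using Comp_assoc[OF si j(1) t(2)] j by simp
    also have "\<dots> = \<sigma>' \<cdot> i'" using Comp_assoc[OF i'(1) s' h(2)] s by simp
    also have "\<dots> = \<sigma>" using Comp_assoc[OF i'(1) i(1) sp(2)] i i' Comp_Id[OF sp(2)] by simp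
    finally show ?thesis by simp
  qed
  moreover have "\<phi> \<sqsubseteq> \<psi> \<cdot> r"
  proof -
    have "\<psi> \<cdot> r = \<psi>' \<cdot> (s \<cdot> i')" unfolding r_def using Comp_assoc[OF si j(1) t(3)] j by simp
    also have "\<dots> = (\<psi>' \<cdot> s) \<cdot> i'" using Comp_assoc[OF i'(1) s' h(3)] by simp
    finally have 1: "\<psi> \<cdot> r = (\<psi>' \<cdot> s) \<cdot> i'" .
    have 2: "\<phi> = \<phi>' \<cdot> i'" using Comp_assoc[OF i'(1) i(1) sp(3)] i i' Comp_Id[OF sp(3)] by simp
    have "\<phi>' \<cdot> i' \<sqsubseteq> (\<psi>' \<cdot> s) \<cdot> i'"
      using Comp_mono i'(1) h(4) Comp_in_hom[OF s' h(3)] s(4) Le_refl[OF i'(1)]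
      unfolding monotone_comp_def by blast
    then show ?thesis using 1 2 by simp
  qed
  ultimately show "\<exists>s \<in> S. s \<in> hom C (Dom C \<sigma>) (Dom C \<tau>) \<and> \<sigma> = \<tau> \<cdot> s \<and> \<phi> \<sqsubseteq> \<psi> \<cdot> s"
    using r by blast
qed

lemma hom_ParE:
  assumes "f \<in> hom (Par C S) A B"
  obtains \<sigma> \<phi> D where "\<sigma> \<in> S" "\<sigma> \<in> hom C D A" "\<phi> \<in> hom C D B" "f = cls \<sigma> \<phi>"
  using iffD1[OF hom_Par_iff assms] by blast

lemma Comp_Par_hom:
  assumes f: "\<sigma> \<in> S" "\<sigma> \<in> hom C D A" "\<phi> \<in> hom C D B"
    and g: "\<tau> \<in> S" "\<tau> \<in> hom C D' B" "\<psi> \<in> hom C D' B'"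
  obtains p q P where "is_pullback C \<phi> \<tau> p q" "p \<in> S" "p \<in> hom C P D" "q \<in> hom C P D'"
    "Comp (Par C S) (cls \<tau> \<psi>) (cls \<sigma> \<phi>) = cls (\<sigma> \<cdot> p) (\<psi> \<cdot> q)"
    "\<sigma> \<cdot> p \<in> S" "\<sigma> \<cdot> p \<in> hom C P A" "\<psi> \<cdot> q \<in> hom C P B'"
proof -
  obtain p q where pb: "is_pullback C \<phi> \<tau> p q"
    using S_pullbacks[OF homD(1)[OF f(3)] g(1)] homD[OF f(3)] homD[OF g(2)] by auto
  have p: "p \<in> hom C (Dom C p) D" "q \<in> hom C (Dom C p) D'"
    using pb homD[OF f(3)] homD[OF g(2)] by (auto simp: is_pullback_def)
  note c = Comp_Par[OF spansI[OF f] spansI[OF g] pb]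
  show thesis
    by (rule that[OF pb S_pullback[OF pb g(1)] p c(1) spansD(1)[OF c(2)]
          Comp_in_hom[OF p(1) f(2)] Comp_in_hom[OF p(2) g(3)]])
qed

lemma Par_category: "category (Par C S)"
proof
  fix f assume "f \<in> Arr (Par C S)"
  then have "f \<in> hom (Par C S) (Dom (Par C S) f) (Cod (Par C S) f)" by (simp add: hom_def)
  then obtain \<sigma> \<phi> D where
    "\<sigma> \<in> hom C D (Dom (Par C S) f)" "\<phi> \<in> hom C D (Cod (Par C S) f)"
    by (rule hom_ParE)
  from homD(5)[OF this(1)] homD(5)[OF this(2)]
  show "Dom (Par C S) f \<in> Obj (Par C S)" "Cod (Par C S) f \<in> Obj (Par C S)"
    by (simp_all add: Par_def)
next
  fix A assume "A \<in> Obj (Par C S)"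
  then have A: "A \<in> Obj C" by (simp add: Par_def)
  have "Id (Par C S) A = cls (Id C A) (Id C A)" by (simp add: Par_def)
  then show "Id (Par C S) A \<in> hom (Par C S) A A"
    using iffD2[OF hom_Par_iff] S_iso[OF Id_iso[OF A]] Id_in_hom[OF A] by metis
next
  fix f A B g D assume fg: "f \<in> hom (Par C S) A B" "g \<in> hom (Par C S) B D"
  obtain \<sigma> \<phi> F where f: "\<sigma> \<in> S" "\<sigma> \<in> hom C F A" "\<phi> \<in> hom C F B" "f = cls \<sigma> \<phi>"
    by (rule hom_ParE[OF fg(1)])
  obtain \<tau> \<psi> G where g: "\<tau> \<in> S" "\<tau> \<in> hom C G B" "\<psi> \<in> hom C G D" "g = cls \<tau> \<psi>"
    by (rule hom_ParE[OF fg(2)])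
  show "g \<cdot>\<^bsub>Par C S\<^esub> f \<in> hom (Par C S) A D"
    unfolding f(4) g(4) by (rule Comp_Par_hom[OF f(1-3) g(1-3)]) (rule iffD2[OF hom_Par_iff], blast)
next
  fix f A B assume "f \<in> hom (Par C S) A B"
  then obtain \<sigma> \<phi> D where f: "\<sigma> \<in> S" "\<sigma> \<in> hom C D A" "\<phi> \<in> hom C D B" "f = cls \<sigma> \<phi>"
    by (rule hom_ParE)
  have A: "A \<in> Obj C" and B: "B \<in> Obj C" using homD f by blast+
  note I = spansI[OF S_iso[OF Id_iso] Id_in_hom Id_in_hom]
  have "f \<cdot>\<^bsub>Par C S\<^esub> cls (Id C A) (Id C A) = cls (Id C A \<cdot> \<sigma>) (\<phi> \<cdot> Id C D)"
    unfolding f(4) by (rule Comp_Par(1)[OF I[OF A A A] spansI[OF f(1-3)] pullback_along_Id[OF f(2)]])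
  then show "f \<cdot>\<^bsub>Par C S\<^esub> Id (Par C S) A = f"
    using f Id_Comp[OF f(2)] Comp_Id[OF f(3)] by (simp add: Par_def)
  have "cls (Id C B) (Id C B) \<cdot>\<^bsub>Par C S\<^esub> f = cls (\<sigma> \<cdot> Id C D) (Id C B \<cdot> \<phi>)"
    unfolding f(4)
    by (rule Comp_Par(1)[OF spansI[OF f(1-3)] I[OF B B B] is_pullback_sym[OF pullback_along_Id[OF f(3)]]])
  then show "Id (Par C S) B \<cdot>\<^bsub>Par C S\<^esub> f = f"
    using f Comp_Id[OF f(2)] Id_Comp[OF f(3)] by (simp add: Par_def)
next
  fix f A B g D h E
  assume m: "f \<in> hom (Par C S) A B" "g \<in> hom (Par C S) B D" "h \<in> hom (Par C S) D E"
  obtain \<sigma> \<phi> F where f: "\<sigma> \<in> S" "\<sigma> \<in> hom C F A" "\<phi> \<in> hom C F B" "f = cls \<sigma> \<phi>"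
    by (rule hom_ParE[OF m(1)])
  obtain \<tau> \<psi> G where g: "\<tau> \<in> S" "\<tau> \<in> hom C G B" "\<psi> \<in> hom C G D" "g = cls \<tau> \<psi>"
    by (rule hom_ParE[OF m(2)])
  obtain \<rho> \<chi> H where h: "\<rho> \<in> S" "\<rho> \<in> hom C H D" "\<chi> \<in> hom C H E" "h = cls \<rho> \<chi>"
    by (rule hom_ParE[OF m(3)])
  obtain p q P where gf: "is_pullback C \<phi> \<tau> p q" "p \<in> S" "p \<in> hom C P F" "q \<in> hom C P G"
    "g \<cdot>\<^bsub>Par C S\<^esub> f = cls (\<sigma> \<cdot> p) (\<psi> \<cdot> q)"
    "\<sigma> \<cdot> p \<in> S" "\<sigma> \<cdot> p \<in> hom C P A" "\<psi> \<cdot> q \<in> hom C P D"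
    unfolding f(4) g(4) by (rule Comp_Par_hom[OF f(1-3) g(1-3)])
  obtain a b Q where hg: "is_pullback C \<psi> \<rho> a b" "a \<in> S" "a \<in> hom C Q G" "b \<in> hom C Q H"
    "h \<cdot>\<^bsub>Par C S\<^esub> g = cls (\<tau> \<cdot> a) (\<chi> \<cdot> b)"
    "\<tau> \<cdot> a \<in> S" "\<tau> \<cdot> a \<in> hom C Q B" "\<chi> \<cdot> b \<in> hom C Q E"
    unfolding g(4) h(4) by (rule Comp_Par_hom[OF g(1-3) h(1-3)])
  obtain c e where ce: "is_pullback C q a c e"
    using S_pullbacks[OF homD(1)[OF gf(4)] hg(2)] homD[OF gf(4)] homD[OF hg(3)] by auto
  have c: "c \<in> hom C (Dom C c) P" "e \<in> hom C (Dom C c) Q"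
    using ce homD[OF gf(4)] homD[OF hg(3)] by (auto simp: is_pullback_def)
  have 1: "is_pullback C (\<psi> \<cdot> q) \<rho> c (b \<cdot> e)" using paste[OF hg(1) ce] .
  have 2: "is_pullback C \<phi> (\<tau> \<cdot> a) (p \<cdot> c) e"
    by (rule is_pullback_sym[OF paste[OF is_pullback_sym[OF gf(1)] is_pullback_sym[OF ce]]])
  have "h \<cdot>\<^bsub>Par C S\<^esub> (g \<cdot>\<^bsub>Par C S\<^esub> f) = cls ((\<sigma> \<cdot> p) \<cdot> c) (\<chi> \<cdot> (b \<cdot> e))"
    unfolding gf(5) h(4) by (rule Comp_Par(1)[OF spansI[OF gf(6-8)] spansI[OF h(1-3)] 1])
  moreover have "(h \<cdot>\<^bsub>Par C S\<^esub> g) \<cdot>\<^bsub>Par C S\<^esub> f = cls (\<sigma> \<cdot> (p \<cdot> c)) ((\<chi> \<cdot> b) \<cdot> e)"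
    unfolding hg(5) f(4) by (rule Comp_Par(1)[OF spansI[OF f(1-3)] spansI[OF hg(6-8)] 2])
  ultimately show "h \<cdot>\<^bsub>Par C S\<^esub> (g \<cdot>\<^bsub>Par C S\<^esub> f) = (h \<cdot>\<^bsub>Par C S\<^esub> g) \<cdot>\<^bsub>Par C S\<^esub> f"
    using Comp_assoc[OF c(1) gf(3) f(2)] Comp_assoc[OF c(2) hg(4) h(3)] by simp
qed

lemma Le_Par_hom:
  assumes "\<sigma> \<in> S" "\<sigma> \<in> hom C D A" "\<phi> \<in> hom C D B" "\<tau> \<in> S" "\<tau> \<in> hom C D' A" "\<psi> \<in> hom C D' B"
  shows "Le (Par C S) (cls \<sigma> \<phi>) (cls \<tau> \<psi>) \<longleftrightarrow> (\<exists>s \<in> S. s \<in> hom C D D' \<and> \<sigma> = \<tau> \<cdot> s \<and> \<phi> \<sqsubseteq> \<psi> \<cdot> s)"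
  using Le_Par[OF spansI[OF assms(1-3)] spansI[OF assms(4-6)]]
    homD[OF assms(2)] homD[OF assms(3)] homD[OF assms(5)] homD[OF assms(6)] by simp

lemma Comp_mono_right:
  "\<lbrakk>f \<in> hom C B D; f' \<in> hom C B D; s \<in> hom C A B; f \<sqsubseteq> f'\<rbrakk> \<Longrightarrow> f \<cdot> s \<sqsubseteq> f' \<cdot> s"
  using Comp_mono Le_refl unfolding monotone_comp_def by blast

theorem Par_ord_category:
  assumes "monotone_comp (Par C S)" shows "ord_category (Par C S)"
proof -
  interpret P: category "Par C S" by (rule Par_category)
  show ?thesis
  proof
    fix f A B assume "f \<in> hom (Par C S) A B"
    then obtain \<sigma> \<phi> D where f: "\<sigma> \<in> S" "\<sigma> \<in> hom C D A" "\<phi> \<in> hom C D B" "f = cls \<sigma> \<phi>"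
      by (rule hom_ParE)
    have D: "D \<in> Obj C" using homD f by blast
    show "f \<sqsubseteq>\<^bsub>Par C S\<^esub> f"
      unfolding f(4) Le_Par_hom[OF f(1-3) f(1-3)]
      using S_iso[OF Id_iso[OF D]] Id_in_hom[OF D] Comp_Id[OF f(2)] Comp_Id[OF f(3)] Le_refl[OF f(3)]
      by auto
  next
    fix f A B g h
    assume m: "f \<in> hom (Par C S) A B" "g \<in> hom (Par C S) A B" "h \<in> hom (Par C S) A B"
      and le: "f \<sqsubseteq>\<^bsub>Par C S\<^esub> g" "g \<sqsubseteq>\<^bsub>Par C S\<^esub> h"
    obtain \<sigma> \<phi> F where f: "\<sigma> \<in> S" "\<sigma> \<in> hom C F A" "\<phi> \<in> hom C F B" "f = cls \<sigma> \<phi>"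
      by (rule hom_ParE[OF m(1)])
    obtain \<tau> \<psi> G where g: "\<tau> \<in> S" "\<tau> \<in> hom C G A" "\<psi> \<in> hom C G B" "g = cls \<tau> \<psi>"
      by (rule hom_ParE[OF m(2)])
    obtain \<rho> \<chi> H where h: "\<rho> \<in> S" "\<rho> \<in> hom C H A" "\<chi> \<in> hom C H B" "h = cls \<rho> \<chi>"
      by (rule hom_ParE[OF m(3)])
    obtain s where s: "s \<in> S" "s \<in> hom C F G" "\<sigma> = \<tau> \<cdot> s" "\<phi> \<sqsubseteq> \<psi> \<cdot> s"
      using le(1) Le_Par_hom[OF f(1-3) g(1-3)] f g by blast
    obtain t where t: "t \<in> S" "t \<in> hom C G H" "\<tau> = \<rho> \<cdot> t" "\<psi> \<sqsubseteq> \<chi> \<cdot> t"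
      using le(2) Le_Par_hom[OF g(1-3) h(1-3)] g h by blast
    have ts: "t \<cdot> s \<in> S" "t \<cdot> s \<in> hom C F H"
      using S_comp[OF s(1) t(1)] homD[OF s(2)] homD[OF t(2)] Comp_in_hom[OF s(2) t(2)] by auto
    have "\<psi> \<cdot> s \<sqsubseteq> (\<chi> \<cdot> t) \<cdot> s"
      using Comp_mono_right[OF g(3) Comp_in_hom[OF t(2) h(3)] s(2) t(4)] .
    then have "\<phi> \<sqsubseteq> \<chi> \<cdot> (t \<cdot> s)"
      using Le_trans[OF f(3) Comp_in_hom[OF s(2) g(3)] Comp_in_hom[OF ts(2) h(3)] s(4)]
        Comp_assoc[OF s(2) t(2) h(3)] by simp
    moreover have "\<sigma> = \<rho> \<cdot> (t \<cdot> s)" using s t Comp_assoc[OF s(2) t(2) h(2)] by simp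
    ultimately show "f \<sqsubseteq>\<^bsub>Par C S\<^esub> h"
      unfolding f(4) h(4) Le_Par_hom[OF f(1-3) h(1-3)] using ts by blast
  next
    fix f A B g
    assume m: "f \<in> hom (Par C S) A B" "g \<in> hom (Par C S) A B"
      and le: "f \<sqsubseteq>\<^bsub>Par C S\<^esub> g" "g \<sqsubseteq>\<^bsub>Par C S\<^esub> f"
    obtain \<sigma> \<phi> F where f: "\<sigma> \<in> S" "\<sigma> \<in> hom C F A" "\<phi> \<in> hom C F B" "f = cls \<sigma> \<phi>"
      by (rule hom_ParE[OF m(1)])
    obtain \<tau> \<psi> G where g: "\<tau> \<in> S" "\<tau> \<in> hom C G A" "\<psi> \<in> hom C G B" "g = cls \<tau> \<psi>"
      by (rule hom_ParE[OF m(2)])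
    obtain s where s: "s \<in> S" "s \<in> hom C F G" "\<sigma> = \<tau> \<cdot> s" "\<phi> \<sqsubseteq> \<psi> \<cdot> s"
      using le(1) Le_Par_hom[OF f(1-3) g(1-3)] f g by blast
    obtain t where t: "t \<in> S" "t \<in> hom C G F" "\<tau> = \<sigma> \<cdot> t" "\<psi> \<sqsubseteq> \<phi> \<cdot> t"
      using le(2) Le_Par_hom[OF g(1-3) f(1-3)] g f by blast
    have F: "F \<in> Obj C" and G: "G \<in> Obj C" using homD f g by blast+
    have st: "s \<cdot> t \<in> hom C G G" "t \<cdot> s \<in> hom C F F" using Comp_in_hom s t by blast+
    have "t \<cdot> s = Id C F"
      by (rule S_monoD[OF f(1)])
        (use st Id_in_hom[OF F] homD[OF f(2)] Comp_Id[OF f(2)] Comp_assoc[OF s(2) t(2) f(2)]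
          s(3) t(3)[symmetric] in auto)
    moreover have "s \<cdot> t = Id C G"
      by (rule S_monoD[OF g(1)])
        (use st Id_in_hom[OF G] homD[OF g(2)] Comp_Id[OF g(2)] Comp_assoc[OF t(2) s(2) g(2)]
          t(3) s(3)[symmetric] in auto)
    ultimately have ts: "t \<cdot> s = Id C F" "is_iso C s"
      using s t homD[OF s(2)] by (auto simp: is_iso_def)
    have "\<psi> \<cdot> s \<sqsubseteq> (\<phi> \<cdot> t) \<cdot> s"
      using Comp_mono_right[OF g(3) Comp_in_hom[OF t(2) f(3)] s(2) t(4)] .
    then have "\<psi> \<cdot> s \<sqsubseteq> \<phi>" using Comp_assoc[OF s(2) t(2) f(3)] ts Comp_Id[OF f(3)] by simp
    then have "\<phi> = \<psi> \<cdot> s" using Le_antisym[OF f(3) Comp_in_hom[OF s(2) g(3)] s(4)] by simp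
    then have "(\<sigma>, \<phi>) \<in> cls \<tau> \<psi>"
      using mem_cls[OF spansI[OF g(1-3)]] s ts homD[OF g(2)] by blast
    then show "f = g" using cls_eqI[OF spansI[OF g(1-3)]] f g by simp
  qed (rule assms)
qed

end

end

(* If partial maps f and g are oplax orthogonal, then so are their total parts \<phi>_f and \<phi>_g: a
   square (u, v) between the latter gives the square ((\<sigma>_f, \<sigma>_g u), (id, v)) from f to g, whose
   diagonal has a domain inclusion that splits; fullness of \<sigma>_g then allows cancelling it.
   Conversely, a square (u, v) from f to g amounts to a square in C from the pullback of \<phi>_f along
   \<sigma>_v to \<phi>_g, which is where the stability of the left class enters; the diagonal is then
   defined on the domain of v. A partial map (\<sigma>, r l) factors as (id, r) after (\<sigma>, l). *)

theory Submission
  imports Defs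
begin

section \<open>Orthogonality and pullbacks for morphisms with named endpoints\<close>

lemma oplax_orthI:
  assumes "f \<in> hom C A B" "g \<in> hom C X Y"
    and "\<And>u v. \<lbrakk>u \<in> hom C A X; v \<in> hom C B Y; v \<cdot>\<^bsub>C\<^esub> f \<sqsubseteq>\<^bsub>C\<^esub> g \<cdot>\<^bsub>C\<^esub> u\<rbrakk>
      \<Longrightarrow> \<exists>d \<in> hom C B X. d \<cdot>\<^bsub>C\<^esub> f \<sqsubseteq>\<^bsub>C\<^esub> u \<and> v \<sqsubseteq>\<^bsub>C\<^esub> g \<cdot>\<^bsub>C\<^esub> d"
  shows "oplax_orth C f g"
proof -
  have "Dom C f = A" "Cod C f = B" "Dom C g = X" "Cod C g = Y"
    using assms(1,2) by (simp_all add: hom_def)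
  then show ?thesis unfolding oplax_orth_def using assms(3) by simp
qed

lemma oplax_orthD:
  assumes "oplax_orth C f g" "f \<in> hom C A B" "g \<in> hom C X Y"
    and "u \<in> hom C A X" "v \<in> hom C B Y" "v \<cdot>\<^bsub>C\<^esub> f \<sqsubseteq>\<^bsub>C\<^esub> g \<cdot>\<^bsub>C\<^esub> u"
  shows "\<exists>d \<in> hom C B X. d \<cdot>\<^bsub>C\<^esub> f \<sqsubseteq>\<^bsub>C\<^esub> u \<and> v \<sqsubseteq>\<^bsub>C\<^esub> g \<cdot>\<^bsub>C\<^esub> d"
proof -
  have "Dom C f = A" "Cod C f = B" "Dom C g = X" "Cod C g = Y"
    using assms(2,3) by (simp_all add: hom_def)
  then show ?thesis using assms(1,4-6) unfolding oplax_orth_def by simp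
qed

lemma is_pullback_lift:
  assumes "is_pullback C f g p q" "f \<in> hom C A F" "g \<in> hom C B F" "p \<in> hom C P A"
    and "h \<in> hom C X A" "k \<in> hom C X B" "f \<cdot>\<^bsub>C\<^esub> h = g \<cdot>\<^bsub>C\<^esub> k"
  obtains w where "w \<in> hom C X P" "p \<cdot>\<^bsub>C\<^esub> w = h" "q \<cdot>\<^bsub>C\<^esub> w = k"
proof -
  have "Dom C f = A" "Dom C g = B" "Dom C p = P"
    using assms(2-4) by (simp_all add: hom_def)
  then have "\<exists>!w. w \<in> hom C X P \<and> p \<cdot>\<^bsub>C\<^esub> w = h \<and> q \<cdot>\<^bsub>C\<^esub> w = k"
    using assms(1,5-7) unfolding is_pullback_def by simp
  then show thesis using that by blast
qed

text \<open>Since \<open>t\<close> is mono, a cone \<open>h\<close>, \<open>k\<close> over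
  \<open>t \<cdot> u\<close> and \<open>t\<close> satisfies \<open>k = u \<cdot> h\<close>, so
  \<open>h\<close> itself is the unique mediating map.\<close>

lemma (in category) pullback_of_factor:
  assumes mono: "is_mono C t" and t: "t \<in> hom C D' B" and u: "u \<in> hom C D D'"
  shows "is_pullback C (t \<cdot> u) t (Id C D) u"
proof -
  have tu: "t \<cdot> u \<in> hom C D B" using Comp_in_hom[OF u t] .
  have I: "Id C D \<in> hom C D D" using Id_in_hom homD(4)[OF u] by blast
  have "\<exists>!w. w \<in> hom C X D \<and> Id C D \<cdot> w = h \<and> u \<cdot> w = k"
    if h: "h \<in> hom C X D" and k: "k \<in> hom C X D'" and e: "(t \<cdot> u) \<cdot> h = t \<cdot> k" for X h k
  proof (rule ex1I[of _ h])
    have "t \<cdot> (u \<cdot> h) = t \<cdot> k" using e Comp_assoc[OF h u t] by simp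
    then have "u \<cdot> h = k"
      using mono Comp_in_hom[OF h u] k homD(2)[OF t] unfolding is_mono_def by blast
    then show "h \<in> hom C X D \<and> Id C D \<cdot> h = h \<and> u \<cdot> h = k" using h Id_Comp by simp
  qed (use Id_Comp in auto)
  then show ?thesis
    unfolding is_pullback_def
    using homD[OF tu] homD[OF t] homD[OF I] I u Comp_Id[OF tu] by auto
qed

section \<open>Partial maps handled through chosen spans, and the transfer of orthogonality between
  \<open>C\<close> and \<open>Par C S\<close>\<close>

context subobject_class
begin

lemma S_fullD:
  "\<lbrakk>s \<in> S; a \<in> hom C X (Dom C s); b \<in> hom C X (Dom C s); s \<cdot> a \<sqsubseteq> s \<cdot> b\<rbrakk> \<Longrightarrow> a \<sqsubseteq> b"
  using S_full unfolding is_full_def by blast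

lemma Comp_mono_left:
  "\<lbrakk>s \<in> hom C B D; f \<in> hom C A B; f' \<in> hom C A B; f \<sqsubseteq> f'\<rbrakk> \<Longrightarrow> s \<cdot> f \<sqsubseteq> s \<cdot> f'"
  using Comp_mono Le_refl unfolding monotone_comp_def by blast

text \<open>The pullback of \<open>\<tau>\<close> along \<open>\<tau> \<cdot> u\<close> may be taken
  to be an identity, so the composite keeps the domain inclusion \<open>\<sigma>\<close>. Maps into
  \<open>X\<close> are built below in the form \<open>\<tau> \<cdot> u\<close> for this
  reason.\<close>

lemma Comp_Par_factor:
  assumes f: "\<sigma> \<in> S" "\<sigma> \<in> hom C D A" and u: "u \<in> hom C D D'"
    and g: "\<tau> \<in> S" "\<tau> \<in> hom C D' B" "\<psi> \<in> hom C D' B'"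
  shows "Comp (Par C S) (cls \<tau> \<psi>) (cls \<sigma> (\<tau> \<cdot> u)) = cls \<sigma> (\<psi> \<cdot> u)"
  using Comp_Par(1)[OF spansI[OF f Comp_in_hom[OF u g(2)]] spansI[OF g]
      pullback_of_factor[OF S_mono[OF g(1)] g(2) u]] Comp_Id[OF f(2)] by simp

text \<open>The case of an identity domain inclusion, through which every map factors.\<close>

lemma Comp_Par_total:
  assumes f: "\<sigma> \<in> S" "\<sigma> \<in> hom C D A" "\<phi> \<in> hom C D B" and v: "v \<in> hom C B B'"
  shows "Comp (Par C S) (cls (Id C B) v) (cls \<sigma> \<phi>) = cls \<sigma> (v \<cdot> \<phi>)"
  using Comp_Par_factor[OF f S_iso[OF Id_iso] Id_in_hom v] homD(4)[OF v] Id_Comp[OF f(3)] by simp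

lemma cls_in_hom:
  "\<lbrakk>\<sigma> \<in> S; \<sigma> \<in> hom C D A; \<phi> \<in> hom C D B\<rbrakk> \<Longrightarrow> cls \<sigma> \<phi> \<in> hom (Par C S) A B"
  using hom_Par_iff by blast

lemma Arr_ParE:
  assumes "f \<in> Arr (Par C S)"
  obtains \<sigma> \<phi> D A B where "\<sigma> \<in> S" "\<sigma> \<in> hom C D A" "\<phi> \<in> hom C D B" "f = cls \<sigma> \<phi>"
proof -
  have "f \<in> hom (Par C S) (Dom (Par C S) f) (Cod (Par C S) f)" using assms by (simp add: hom_def)
  then show thesis using that by (rule hom_ParE)
qed

lemma Par_classI:
  "\<lbrakk>\<sigma> \<in> S; \<sigma> \<in> hom C D A; \<phi> \<in> hom C D B; \<phi> \<in> K\<rbrakk> \<Longrightarrow> cls \<sigma> \<phi> \<in> Par_class C S K"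
  using Arr_ParI[OF spansI] cls_self[OF spansI] unfolding Par_class_def by blast

text \<open>\<open>Par_class\<close> asks only that some span in the isomorphism class have its
  second leg in \<open>K\<close>; the partial map is presented here by that very span.\<close>

lemma Par_classE:
  assumes "f \<in> Par_class C S K"
  obtains \<sigma> \<phi> D A B where
    "\<sigma> \<in> S" "\<sigma> \<in> hom C D A" "\<phi> \<in> hom C D B" "\<phi> \<in> K" "f = cls \<sigma> \<phi>"
proof -
  from assms obtain \<sigma> \<phi> where f: "f \<in> Arr (Par C S)" "(\<sigma>, \<phi>) \<in> f" "\<phi> \<in> K"
    by (auto simp: Par_class_def)
  obtain \<sigma>' \<phi>' D A B where f': "\<sigma>' \<in> S" "\<sigma>' \<in> hom C D A" "\<phi>' \<in> hom C D B" "f = cls \<sigma>' \<phi>'"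
    using Arr_ParE[OF f(1)] .
  have eq: "f = cls \<sigma> \<phi>" using cls_eqI[OF spansI[OF f'(1-3)]] f(2) f'(4) by simp
  have "(\<sigma>, \<phi>) \<in> spans C S" using f(2) f'(4) by (auto simp: span_iso_def)
  from that[OF spansD(1-3)[OF this] f(3) eq] show thesis .
qed

text \<open>A square in \<open>C\<close> becomes one of partial maps whose two composites share the
  domain inclusion \<open>\<sigma>\<close>. The diagonal obtained is defined on all of
  \<open>B\<close>, because a total map lies below its composite with
  \<open>cls \<tau> \<psi>\<close>, and it factors through \<open>\<tau>\<close>. With
  \<open>\<sigma>\<close> or \<open>\<tau>\<close> an identity, this tests a partial map against the
  morphisms of the opposite class.\<close>

lemma orth_total_if_orth_Par:
  assumes f: "\<sigma> \<in> S" "\<sigma> \<in> hom C D A" "\<phi> \<in> hom C D B"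
    and g: "\<tau> \<in> S" "\<tau> \<in> hom C D' X" "\<psi> \<in> hom C D' Y"
    and orth: "oplax_orth (Par C S) (cls \<sigma> \<phi>) (cls \<tau> \<psi>)"
  shows "oplax_orth C \<phi> \<psi>"
proof -
  have "\<exists>d \<in> hom C B D'. d \<cdot> \<phi> \<sqsubseteq> u \<and> v \<sqsubseteq> \<psi> \<cdot> d"
    if u: "u \<in> hom C D D'" and v: "v \<in> hom C B Y" and sq: "v \<cdot> \<phi> \<sqsubseteq> \<psi> \<cdot> u" for u v
  proof -
    have I: "Id C B \<in> S" "Id C B \<in> hom C B B"
      using S_iso[OF Id_iso] Id_in_hom homD(4)[OF v] by blast+
    have tu: "\<tau> \<cdot> u \<in> hom C D X" using Comp_in_hom[OF u g(2)] .
    have ID: "Id C D \<in> S" "Id C D \<in> hom C D D"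
      using S_iso[OF Id_iso] Id_in_hom homD(4)[OF u] by blast+
    \<comment> \<open>Both sides have domain inclusion \<open>\<sigma>\<close>, so
      \<open>Id C D\<close> witnesses the order and only \<open>sq\<close> remains.\<close>
    have "cls \<sigma> (v \<cdot> \<phi>) \<sqsubseteq>\<^bsub>Par C S\<^esub> cls \<sigma> (\<psi> \<cdot> u)"
      unfolding Le_Par_hom[OF f(1,2) Comp_in_hom[OF f(3) v] f(1,2) Comp_in_hom[OF u g(3)]]
      using ID sq Comp_Id[OF f(2)] Comp_Id[OF Comp_in_hom[OF u g(3)]] by auto
    then have "cls (Id C B) v \<cdot>\<^bsub>Par C S\<^esub> cls \<sigma> \<phi> \<sqsubseteq>\<^bsub>Par C S\<^esub> cls \<tau> \<psi> \<cdot>\<^bsub>Par C S\<^esub> cls \<sigma> (\<tau> \<cdot> u)"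
      unfolding Comp_Par_total[OF f v] Comp_Par_factor[OF f(1,2) u g] .
    then obtain d where d: "d \<in> hom (Par C S) B X"
      "d \<cdot>\<^bsub>Par C S\<^esub> cls \<sigma> \<phi> \<sqsubseteq>\<^bsub>Par C S\<^esub> cls \<sigma> (\<tau> \<cdot> u)"
      "cls (Id C B) v \<sqsubseteq>\<^bsub>Par C S\<^esub> cls \<tau> \<psi> \<cdot>\<^bsub>Par C S\<^esub> d"
      using oplax_orthD[OF orth cls_in_hom[OF f] cls_in_hom[OF g] cls_in_hom[OF f(1,2) tu]
          cls_in_hom[OF I v]] by blast
    obtain \<delta> \<theta> H where h: "\<delta> \<in> S" "\<delta> \<in> hom C H B" "\<theta> \<in> hom C H X" "d = cls \<delta> \<theta>"
      by (rule hom_ParE[OF d(1)])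
    obtain a b Q where gd: "is_pullback C \<theta> \<tau> a b" "a \<in> S" "a \<in> hom C Q H" "b \<in> hom C Q D'"
      "cls \<tau> \<psi> \<cdot>\<^bsub>Par C S\<^esub> d = cls (\<delta> \<cdot> a) (\<psi> \<cdot> b)"
      "\<delta> \<cdot> a \<in> S" "\<delta> \<cdot> a \<in> hom C Q B" "\<psi> \<cdot> b \<in> hom C Q Y"
      unfolding h(4) by (rule Comp_Par_hom[OF h(1-3) g])
    obtain p q P where pq: "is_pullback C \<phi> \<delta> p q" "p \<in> S" "p \<in> hom C P D" "q \<in> hom C P H"
      "d \<cdot>\<^bsub>Par C S\<^esub> cls \<sigma> \<phi> = cls (\<sigma> \<cdot> p) (\<theta> \<cdot> q)"
      "\<sigma> \<cdot> p \<in> S" "\<sigma> \<cdot> p \<in> hom C P A" "\<theta> \<cdot> q \<in> hom C P X"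
      unfolding h(4) by (rule Comp_Par_hom[OF f h(1-3)])
    \<comment> \<open>The left side of the inequality is total, so its witness \<open>s\<close> is a
      right inverse of \<open>\<delta> \<cdot> a\<close>.\<close>
    obtain s where s: "s \<in> hom C B Q" "Id C B = (\<delta> \<cdot> a) \<cdot> s" "v \<sqsubseteq> (\<psi> \<cdot> b) \<cdot> s"
      using d(3) unfolding gd(5) Le_Par_hom[OF I v gd(6-8)] by blast
    obtain t where t: "t \<in> hom C P D" "\<sigma> \<cdot> p = \<sigma> \<cdot> t" "\<theta> \<cdot> q \<sqsubseteq> (\<tau> \<cdot> u) \<cdot> t"
      using d(2) unfolding pq(5) Le_Par_hom[OF pq(6-8) f(1,2) tu] by blast
    have "p = t" using S_monoD[OF f(1)] homD(2)[OF f(2)] pq(3) t by simp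
    then have le: "\<theta> \<cdot> q \<sqsubseteq> (\<tau> \<cdot> u) \<cdot> p" using t(3) by simp
    \<comment> \<open>\<open>c\<close> is a right inverse of \<open>\<delta>\<close>, so
      \<open>\<theta> \<cdot> c\<close> is the total form of \<open>d\<close>. It equals
      \<open>\<tau> \<cdot> (b \<cdot> s)\<close>, which makes \<open>b \<cdot> s\<close> the
      diagonal sought in \<open>C\<close>.\<close>
    define c where "c = a \<cdot> s"
    have c: "c \<in> hom C B H" "\<delta> \<cdot> c = Id C B"
      using Comp_in_hom[OF s(1) gd(3)] Comp_assoc[OF s(1) gd(3) h(2)] s(2) by (simp_all add: c_def)
    have bs: "b \<cdot> s \<in> hom C B D'" using Comp_in_hom[OF s(1) gd(4)] .
    have ab: "\<theta> \<cdot> a = \<tau> \<cdot> b" using gd(1) by (simp add: is_pullback_def)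
    have \<theta>c: "\<theta> \<cdot> c = \<tau> \<cdot> (b \<cdot> s)"
      using Comp_assoc[OF s(1) gd(3) h(3)] Comp_assoc[OF s(1) gd(4) g(2)] ab by (simp add: c_def)
    have c\<phi>: "c \<cdot> \<phi> \<in> hom C D H" using Comp_in_hom[OF f(3) c(1)] .
    \<comment> \<open>The cone \<open>Id C D\<close>, \<open>c \<cdot> \<phi>\<close> over
      \<open>\<phi>\<close> and \<open>\<delta>\<close> yields a right inverse \<open>w\<close> of
      \<open>p\<close>; precomposing with it moves the inequality \<open>le\<close> from
      \<open>P\<close> to \<open>D\<close>.\<close>
    have "\<phi> \<cdot> Id C D = \<delta> \<cdot> (c \<cdot> \<phi>)"
      using Comp_assoc[OF f(3) c(1) h(2)] c(2) Id_Comp[OF f(3)] Comp_Id[OF f(3)] by simp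
    then obtain w where w: "w \<in> hom C D P" "p \<cdot> w = Id C D" "q \<cdot> w = c \<cdot> \<phi>"
      by (rule is_pullback_lift[OF pq(1) f(3) h(2) pq(3) ID(2) c\<phi>])
    have "(\<theta> \<cdot> q) \<cdot> w \<sqsubseteq> ((\<tau> \<cdot> u) \<cdot> p) \<cdot> w"
      by (rule Comp_mono_right[OF pq(8) Comp_in_hom[OF pq(3) tu] w(1) le])
    moreover have "((\<tau> \<cdot> u) \<cdot> p) \<cdot> w = \<tau> \<cdot> u"
      using Comp_assoc[OF w(1) pq(3) tu] w(2) Comp_Id[OF tu] by simp
    moreover have "(\<theta> \<cdot> q) \<cdot> w = \<tau> \<cdot> ((b \<cdot> s) \<cdot> \<phi>)"
      using Comp_assoc[OF w(1) pq(4) h(3)] w(3) Comp_assoc[OF f(3) c(1) h(3)] \<theta>c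
        Comp_assoc[OF f(3) bs g(2)] by simp
    ultimately have "(b \<cdot> s) \<cdot> \<phi> \<sqsubseteq> u"
      using S_fullD[OF g(1)] Comp_in_hom[OF f(3) bs] u homD(2)[OF g(2)] by simp
    moreover have "v \<sqsubseteq> \<psi> \<cdot> (b \<cdot> s)" using s(3) Comp_assoc[OF s(1) gd(4) g(3)] by simp
    ultimately show ?thesis using bs by blast
  qed
  then show ?thesis using oplax_orthI[OF f(3) g(3)] by blast
qed

text \<open>The lifting problem lives on the domain of \<open>V\<close>: \<open>\<phi>\<close> is
  replaced by its pullback along the domain inclusion \<open>\<beta>\<close> of \<open>V\<close>,
  and a lift against \<open>\<psi>\<close>, followed by \<open>\<tau>\<close>, is the partial
  diagonal. The hypothesis ranges over all pullbacks along \<open>S\<close> because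
  \<open>\<beta>\<close> varies with the square.\<close>

lemma orth_Par_if_orth_pullbacks:
  assumes f: "\<sigma> \<in> S" "\<sigma> \<in> hom C D A" "\<phi> \<in> hom C D B"
    and g: "\<tau> \<in> S" "\<tau> \<in> hom C D' X" "\<psi> \<in> hom C D' Y"
    and orth: "\<And>s p q. s \<in> S \<Longrightarrow> is_pullback C s \<phi> p q \<Longrightarrow> oplax_orth C p \<psi>"
  shows "oplax_orth (Par C S) (cls \<sigma> \<phi>) (cls \<tau> \<psi>)"
proof -
  have "\<exists>d \<in> hom (Par C S) B X.
      d \<cdot>\<^bsub>Par C S\<^esub> cls \<sigma> \<phi> \<sqsubseteq>\<^bsub>Par C S\<^esub> U \<and> V \<sqsubseteq>\<^bsub>Par C S\<^esub> cls \<tau> \<psi> \<cdot>\<^bsub>Par C S\<^esub> d"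
    if U: "U \<in> hom (Par C S) A X" and V: "V \<in> hom (Par C S) B Y"
      and sq: "V \<cdot>\<^bsub>Par C S\<^esub> cls \<sigma> \<phi> \<sqsubseteq>\<^bsub>Par C S\<^esub> cls \<tau> \<psi> \<cdot>\<^bsub>Par C S\<^esub> U" for U V
  proof -
    obtain \<alpha> u F where u: "\<alpha> \<in> S" "\<alpha> \<in> hom C F A" "u \<in> hom C F X" "U = cls \<alpha> u"
      by (rule hom_ParE[OF U])
    obtain \<beta> v G where v: "\<beta> \<in> S" "\<beta> \<in> hom C G B" "v \<in> hom C G Y" "V = cls \<beta> v"
      by (rule hom_ParE[OF V])
    obtain p q P where pq: "is_pullback C \<phi> \<beta> p q" "p \<in> S" "p \<in> hom C P D" "q \<in> hom C P G"
      "V \<cdot>\<^bsub>Par C S\<^esub> cls \<sigma> \<phi> = cls (\<sigma> \<cdot> p) (v \<cdot> q)"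
      "\<sigma> \<cdot> p \<in> S" "\<sigma> \<cdot> p \<in> hom C P A" "v \<cdot> q \<in> hom C P Y"
      unfolding v(4) by (rule Comp_Par_hom[OF f v(1-3)])
    obtain a b Q where ab: "is_pullback C u \<tau> a b" "a \<in> S" "a \<in> hom C Q F" "b \<in> hom C Q D'"
      "cls \<tau> \<psi> \<cdot>\<^bsub>Par C S\<^esub> U = cls (\<alpha> \<cdot> a) (\<psi> \<cdot> b)"
      "\<alpha> \<cdot> a \<in> S" "\<alpha> \<cdot> a \<in> hom C Q A" "\<psi> \<cdot> b \<in> hom C Q Y"
      unfolding u(4) by (rule Comp_Par_hom[OF u(1-3) g])
    \<comment> \<open>\<open>s\<close> includes the domain of the left composite into that of the
      right one; with it, \<open>b \<cdot> s\<close> and \<open>v\<close> form an oplax square from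
      the pulled-back \<open>q\<close> to \<open>\<psi>\<close>.\<close>
    obtain s where s: "s \<in> S" "s \<in> hom C P Q" "\<sigma> \<cdot> p = (\<alpha> \<cdot> a) \<cdot> s" "v \<cdot> q \<sqsubseteq> (\<psi> \<cdot> b) \<cdot> s"
      using sq unfolding pq(5) ab(5) Le_Par_hom[OF pq(6-8) ab(6-8)] by blast
    have bs: "b \<cdot> s \<in> hom C P D'" using Comp_in_hom[OF s(2) ab(4)] .
    have "v \<cdot> q \<sqsubseteq> \<psi> \<cdot> (b \<cdot> s)" using s(4) Comp_assoc[OF s(2) ab(4) g(3)] by simp
    then obtain d where d: "d \<in> hom C G D'" "d \<cdot> q \<sqsubseteq> b \<cdot> s" "v \<sqsubseteq> \<psi> \<cdot> d"
      using oplax_orthD[OF orth[OF v(1) is_pullback_sym[OF pq(1)]] pq(4) g(3) bs v(3)] by blast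
    have td: "\<tau> \<cdot> d \<in> hom C G X" and \<psi>d: "\<psi> \<cdot> d \<in> hom C G Y"
      using Comp_in_hom[OF d(1)] g by blast+
    have as: "a \<cdot> s \<in> S" "a \<cdot> s \<in> hom C P F"
      using S_comp[OF s(1) ab(2)] homD[OF s(2)] homD[OF ab(3)] Comp_in_hom[OF s(2) ab(3)] by auto
    \<comment> \<open>This diagonal has the same domain inclusion as \<open>V\<close>, so the
      pullback \<open>p\<close>, \<open>q\<close> taken for \<open>V\<close> also computes its
      composite.\<close>
    have comp: "cls \<beta> (\<tau> \<cdot> d) \<cdot>\<^bsub>Par C S\<^esub> cls \<sigma> \<phi> = cls (\<sigma> \<cdot> p) ((\<tau> \<cdot> d) \<cdot> q)"
      by (rule Comp_Par(1)[OF spansI[OF f] spansI[OF v(1,2) td] pq(1)])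
    have "u \<cdot> a = \<tau> \<cdot> b" using ab(1) by (simp add: is_pullback_def)
    then have "\<tau> \<cdot> (b \<cdot> s) = u \<cdot> (a \<cdot> s)"
      using Comp_assoc[OF s(2) ab(3) u(3)] Comp_assoc[OF s(2) ab(4) g(2)] by simp
    then have "(\<tau> \<cdot> d) \<cdot> q \<sqsubseteq> u \<cdot> (a \<cdot> s)"
      using Comp_mono_left[OF g(2) Comp_in_hom[OF pq(4) d(1)] bs d(2)]
        Comp_assoc[OF pq(4) d(1) g(2)] by simp
    moreover have "\<sigma> \<cdot> p = \<alpha> \<cdot> (a \<cdot> s)" using s(3) Comp_assoc[OF s(2) ab(3) u(2)] by simp
    ultimately have "cls \<beta> (\<tau> \<cdot> d) \<cdot>\<^bsub>Par C S\<^esub> cls \<sigma> \<phi> \<sqsubseteq>\<^bsub>Par C S\<^esub> U"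
      unfolding comp u(4) Le_Par_hom[OF pq(6,7) Comp_in_hom[OF pq(4) td] u(1-3)] using as by blast
    \<comment> \<open>By \<open>Comp_Par_factor\<close> both sides have domain inclusion
      \<open>\<beta>\<close>, so an identity is the witness.\<close>
    moreover have "V \<sqsubseteq>\<^bsub>Par C S\<^esub> cls \<tau> \<psi> \<cdot>\<^bsub>Par C S\<^esub> cls \<beta> (\<tau> \<cdot> d)"
      unfolding v(4) Comp_Par_factor[OF v(1,2) d(1) g] Le_Par_hom[OF v(1-3) v(1,2) \<psi>d]
      using S_iso[OF Id_iso] Id_in_hom homD(4)[OF v(2)] Comp_Id[OF v(2)] Comp_Id[OF \<psi>d] d(3)
      by (intro bexI[of _ "Id C G"]) auto
    ultimately show ?thesis using cls_in_hom[OF v(1,2) td] by blast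
  qed
  then show ?thesis using oplax_orthI[OF cls_in_hom[OF f] cls_in_hom[OF g]] by blast
qed

end

section \<open>The factorisation system on partial maps\<close>

theorem mainTheorem4:
  fixes C :: "('o, 'a, 'm) ord_cat_scheme" and S E M :: "'a set"
  assumes "subobject_class C S"
    and "monotone_comp (Par C S)"
    and "oplax_wfs C E M"
    and "pullback_stable C E S"
  shows "oplax_wfs (Par C S) (Par_class C S E) (Par_class C S M)"
proof -
  interpret subobject_class C S by fact
  interpret W: oplax_wfs C E M by fact
  interpret P: ord_category "Par C S" by (rule Par_ord_category) fact
  have orth_E_M: "oplax_orth C e m" if "e \<in> E" "m \<in> M" for e m
    using that W.right_class by blast
  have E_Arr: "e \<in> Arr C" if "e \<in> E" for e using that W.left_class by blast
  have M_Arr: "m \<in> Arr C" if "m \<in> M" for m using that W.right_class by blast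
  have orth: "oplax_orth (Par C S) f g" if fg: "f \<in> Par_class C S E" "g \<in> Par_class C S M" for f g
  proof -
    obtain \<sigma> \<phi> D A B where
      f: "\<sigma> \<in> S" "\<sigma> \<in> hom C D A" "\<phi> \<in> hom C D B" "\<phi> \<in> E" "f = cls \<sigma> \<phi>"
      using Par_classE[OF fg(1)] .
    obtain \<tau> \<psi> D' X Y where
      g: "\<tau> \<in> S" "\<tau> \<in> hom C D' X" "\<psi> \<in> hom C D' Y" "\<psi> \<in> M" "g = cls \<tau> \<psi>"
      using Par_classE[OF fg(2)] .
    show ?thesis
      unfolding f(5) g(5)
    proof (rule orth_Par_if_orth_pullbacks[OF f(1-3) g(1-3)])
      fix s p q assume "s \<in> S" "is_pullback C s \<phi> p q"
      \<comment> \<open>\<open>p\<close> is the side opposite \<open>\<phi>\<close>, hence the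
        pullback of a member of \<open>E\<close> along a member of \<open>S\<close>.\<close>
      then have "p \<in> E" using assms(4) f(4) unfolding pullback_stable_def by blast
      then show "oplax_orth C p \<psi>" using orth_E_M g(4) by blast
    qed
  qed
  have right: "g \<in> Par_class C S M"
    if g_Arr: "g \<in> Arr (Par C S)"
      and g_orth: "\<And>f. f \<in> Par_class C S E \<Longrightarrow> oplax_orth (Par C S) f g" for g
  proof -
    obtain \<tau> \<psi> D X Y where g: "\<tau> \<in> S" "\<tau> \<in> hom C D X" "\<psi> \<in> hom C D Y" "g = cls \<tau> \<psi>"
      using Arr_ParE[OF g_Arr] .
    \<comment> \<open>Each \<open>e\<close> is viewed as a total partial map with identity domain
      inclusion; orthogonality of \<open>g\<close> to these forces \<open>\<psi>\<close> into
      \<open>M\<close>.\<close>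
    have "oplax_orth C e \<psi>" if e: "e \<in> E" for e
    proof -
      have h: "e \<in> hom C (Dom C e) (Cod C e)" using ArrI[OF E_Arr[OF e]] .
      note I = S_iso[OF Id_iso[OF homD(4)[OF h]]] Id_in_hom[OF homD(4)[OF h]]
      show ?thesis
        using orth_total_if_orth_Par[OF I h g(1-3)] g_orth[OF Par_classI[OF I h e]] g(4) by simp
    qed
    then have "\<psi> \<in> M" using W.right_class homD[OF g(3)] by blast
    then show ?thesis using Par_classI g by blast
  qed
  have left: "f \<in> Par_class C S E"
    if f_Arr: "f \<in> Arr (Par C S)"
      and f_orth: "\<And>g. g \<in> Par_class C S M \<Longrightarrow> oplax_orth (Par C S) f g" for f
  proof -
    obtain \<sigma> \<phi> D A B where f: "\<sigma> \<in> S" "\<sigma> \<in> hom C D A" "\<phi> \<in> hom C D B" "f = cls \<sigma> \<phi>"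
      using Arr_ParE[OF f_Arr] .
    \<comment> \<open>Dually, each \<open>m\<close> is viewed as a total partial map.\<close>
    have "oplax_orth C \<phi> m" if m: "m \<in> M" for m
    proof -
      have h: "m \<in> hom C (Dom C m) (Cod C m)" using ArrI[OF M_Arr[OF m]] .
      note I = S_iso[OF Id_iso[OF homD(4)[OF h]]] Id_in_hom[OF homD(4)[OF h]]
      show ?thesis
        using orth_total_if_orth_Par[OF f(1-3) I h] f_orth[OF Par_classI[OF I h m]] f(4) by simp
    qed
    then have "\<phi> \<in> E" using W.left_class homD[OF f(3)] by blast
    then show ?thesis using Par_classI f by blast
  qed
  have Arr: "Par_class C S K \<subseteq> Arr (Par C S)" for K by (auto simp: Par_class_def)
  show ?thesis
  proof
    show "Par_class C S M =
        {g \<in> Arr (Par C S). \<forall>f \<in> Par_class C S E. oplax_orth (Par C S) f g}"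
      using Arr orth right by blast
    show "Par_class C S E =
        {f \<in> Arr (Par C S). \<forall>g \<in> Par_class C S M. oplax_orth (Par C S) f g}"
      using Arr orth left by blast
  next
    fix f assume f_Arr: "f \<in> Arr (Par C S)"
    obtain \<sigma> \<phi> D A B where f: "\<sigma> \<in> S" "\<sigma> \<in> hom C D A" "\<phi> \<in> hom C D B" "f = cls \<sigma> \<phi>"
      using Arr_ParE[OF f_Arr] .
    obtain l r where lr: "l \<in> E" "r \<in> M" "Cod C l = Dom C r" "\<phi> = r \<cdot>\<^bsub>C\<^esub> l"
      using W.factorisation[OF homD(1)[OF f(3)]] by blast
    have l': "l \<in> hom C (Dom C l) (Dom C r)" and r': "r \<in> hom C (Dom C r) (Cod C r)"
      using lr E_Arr M_Arr by (auto simp: hom_def)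
    \<comment> \<open>The factorisation matches only the inner endpoints; the outer ones are read
      off from \<open>\<phi>\<close>.\<close>
    have "Dom C l = D" "Cod C r = B"
      using homD[OF Comp_in_hom[OF l' r']] homD[OF f(3)] lr(4) by simp_all
    with l' r' have l: "l \<in> hom C D (Dom C r)" and r: "r \<in> hom C (Dom C r) B" by simp_all
    note I = S_iso[OF Id_iso[OF homD(4)[OF r]]] Id_in_hom[OF homD(4)[OF r]]
    have "f = cls (Id C (Dom C r)) r \<cdot>\<^bsub>Par C S\<^esub> cls \<sigma> l"
      using Comp_Par_total[OF f(1,2) l r] f(4) lr(4) by simp
    moreover have "Cod (Par C S) (cls \<sigma> l) = Dom (Par C S) (cls (Id C (Dom C r)) r)"
      using Cod_Par[OF spansI[OF f(1,2) l]] Dom_Par[OF spansI[OF I r]] lr(3) homD[OF I(2)] by simp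
    ultimately show "\<exists>l \<in> Par_class C S E. \<exists>r \<in> Par_class C S M.
        Cod (Par C S) l = Dom (Par C S) r \<and> f = r \<cdot>\<^bsub>Par C S\<^esub> l"
      by (intro bexI[OF _ Par_classI[OF f(1,2) l lr(1)]] bexI[OF _ Par_classI[OF I r lr(2)]] conjI)
  qed
qed

end
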